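(* Let $G$ be a finitely generated group acting transitively (on the right) on a space $X$. Fix a finite generating set $S$ of $G$ and let $\Gamma=(X,E)$ be the associated Schreier graph. Assume that $\Gamma$ is a transient graph. Then for every probability measure $\mu$ on $G$ with a finite first moment such that $\operatorname{supp}(\mu)$ generates $G$ as a semigroup, the induced random walk on $\Gamma$ almost surely converges towards an end of the graph $\Gamma$.
   Context: Schreier graph: $\Gamma=(X,E)$ is the undirected graph with vertex set $X$ and edges $E=\{(x,x.s) : x\in X,\ s\in S\}$; it is connected since the action is transitive. A graph is transient if the simple random walk on it is transient. A random walk is transient if, for any point, almost every trajectory leaves that point after finite time, i.e. visits it only finitely often; equivalently, $\sum_{n}p^{(n)}(x,x)<\infty$ for all $x\in X$, where $p^{(n)}$ denotes the $n$-step transition probability. First moment: the first moment of $\mu$ is $\sum_{g\in G}|g|\,\mu(g)$, where $|g|$ is the word length of $g$ with respect to a finite generating set. Induced random walk: let $(h_n)$ be i.i.d. with law $\mu$, let $g_0=e$ and $g_{n+1}=g_nh_n$. For a fixed starting point $\mathfrak{o}\in X$, the induced random walk on $X$ (or on $\Gamma$) starting at $\mathfrak{o}$ is $(\mathfrak{o}.g_n)_{n}$; it is the Markov chain with kernel $P(x,y)=\sum_{g\in G:\, x.g=y}\mu(g)$. Ends: for a finite set $K\subset X$ let $\pi_0(X\setminus K)$ be the set of connected components of the subgraph obtained by deleting the vertices of $K$ and the edges adjacent to them. For $K_1\subseteq K_2$ there is a natural map $\pi_0(X\setminus K_2)\to\pi_0(X\setminus K_1)$ sending a component to the component containing it. The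 end space is the inverse limit $\varprojlim_K \pi_0(X\setminus K)$ over finite $K\subset X$. Equivalently, for an increasing exhaustive sequence $K_1\subset K_2\subset\dots$ of finite subsets of $X$, an end is a sequence $U_1\supseteq U_2\supseteq\dots$ where $U_n$ is an infinite connected component of the complement of $K_n$. A trajectory $(x_n)$ converges towards an end $(U_K)_K$ if for every finite $K\subset X$ one has $x_n\in U_K$ for all sufficiently large $n$. *)

theory Defs
  imports "HOL-Probability.Probability" "HOL-Algebra.Generated_Groups"
begin

section \<open>Right actions and Schreier graphs\<close>

locale right_action = group G for G (structure) +
  fixes X :: "'x set" and act :: "'x \<Rightarrow> 'g \<Rightarrow> 'x"
  assumes act_closed: "\<lbrakk>x \<in> X; g \<in> carrier G\<rbrakk> \<Longrightarrow> act x g \<in> X"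
    and act_one: "x \<in> X \<Longrightarrow> act x \<one> = x"
    and act_mult: "\<lbrakk>x \<in> X; g \<in> carrier G; h \<in> carrier G\<rbrakk>
      \<Longrightarrow> act x (g \<otimes> h) = act (act x g) h"

locale transitive_right_action = right_action +
  assumes transitive: "\<lbrakk>x \<in> X; y \<in> X\<rbrakk> \<Longrightarrow> \<exists>g\<in>carrier G. act x g = y"

definition finite_generating_set :: "('g, 'm) monoid_scheme \<Rightarrow> 'g set \<Rightarrow> bool" where
  "finite_generating_set G S \<longleftrightarrow> finite S \<and> S \<subseteq> carrier G \<and> generate G S = carrier G"

text \<open>An undirected graph on a vertex set is given by its adjacency relation, a symmetric set of
  ordered pairs. A loop makes a vertex adjacent to itself; parallel edges are not recorded.\<close>

definition schreier_adj :: "'x set \<Rightarrow> ('x \<Rightarrow> 'g \<Rightarrow> 'x) \<Rightarrow> 'g set \<Rightarrow> 'x rel" where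
  "schreier_adj X act S = (let E = {(x, act x s) | x s. x \<in> X \<and> s \<in> S} in E \<union> E\<inverse>)"


section \<open>Simple random walk and transience\<close>

text \<open>At a vertex without neighbours the walk stays put, so that the one-point graph is
  recurrent whether or not it carries a loop.\<close>

definition srw_kernel :: "'x rel \<Rightarrow> 'x \<Rightarrow> 'x pmf" where
  "srw_kernel A x = (if A `` {x} = {} then return_pmf x else pmf_of_set (A `` {x}))"

text \<open>A Markov chain with kernel \<open>K\<close> is realised by independent choices \<open>\<omega> (n, x)\<close>, each of law
  \<open>K x\<close>, where \<open>\<omega> (n, x)\<close> is the next state if the chain is in state \<open>x\<close> at time \<open>n\<close>.\<close>

definition markov_space :: "('x \<Rightarrow> 'x pmf) \<Rightarrow> (nat \<times> 'x \<Rightarrow> 'x) measure" where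
  "markov_space K = PiM UNIV (\<lambda>(n, x). measure_pmf (K x))"

primrec markov_path :: "'x \<Rightarrow> (nat \<times> 'x \<Rightarrow> 'x) \<Rightarrow> nat \<Rightarrow> 'x" where
  "markov_path x \<omega> 0 = x"
| "markov_path x \<omega> (Suc n) = \<omega> (n, markov_path x \<omega> n)"

definition transient_graph :: "'x set \<Rightarrow> 'x rel \<Rightarrow> bool" where
  "transient_graph X A \<longleftrightarrow> (\<forall>x\<in>X. \<forall>y\<in>X.
     AE \<omega> in markov_space (srw_kernel A). finite {n. markov_path x \<omega> n = y})"


section \<open>Ends\<close>

definition component_of :: "'x set \<Rightarrow> 'x rel \<Rightarrow> 'x set \<Rightarrow> 'x \<Rightarrow> 'x set" where
  "component_of X A K x = (A \<inter> (X - K) \<times> (X - K))\<^sup>* `` {x}"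

definition components_off :: "'x set \<Rightarrow> 'x rel \<Rightarrow> 'x set \<Rightarrow> 'x set set" where
  "components_off X A K = component_of X A K ` (X - K)"

text \<open>The inverse limit over finite \<open>K\<close> of the sets of components of \<open>X - K\<close>: the bonding map
  for \<open>K \<subseteq> L\<close> sends \<open>V\<close> to the unique component containing \<open>V\<close>, so compatibility of a
  family \<open>U\<close> amounts to \<open>U L \<subseteq> U K\<close>.\<close>

definition graph_ends :: "'x set \<Rightarrow> 'x rel \<Rightarrow> ('x set \<Rightarrow> 'x set) set" where
  "graph_ends X A = {U \<in> (\<Pi>\<^sub>E K\<in>{K. finite K \<and> K \<subseteq> X}. components_off X A K).
     \<forall>K L. finite L \<and> L \<subseteq> X \<and> K \<subseteq> L \<longrightarrow> U L \<subseteq> U K}"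

definition converges_to_end :: "'x set \<Rightarrow> (nat \<Rightarrow> 'x) \<Rightarrow> ('x set \<Rightarrow> 'x set) \<Rightarrow> bool" where
  "converges_to_end X x U \<longleftrightarrow>
     (\<forall>K. finite K \<and> K \<subseteq> X \<longrightarrow> (\<forall>\<^sub>F n in sequentially. x n \<in> U K))"


section \<open>Random walks on groups\<close>

definition word_length :: "('g, 'm) monoid_scheme \<Rightarrow> 'g set \<Rightarrow> 'g \<Rightarrow> nat" where
  "word_length G S g = (LEAST n. \<exists>w. length w = n \<and> set w \<subseteq> S \<union> m_inv G ` S \<and>
     foldr (mult G) w (one G) = g)"

definition finite_first_moment ::
    "('g, 'm) monoid_scheme \<Rightarrow> 'g set \<Rightarrow> 'g pmf \<Rightarrow> bool" where
  "finite_first_moment G S \<mu> \<longleftrightarrow>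
     (\<lambda>g. real (word_length G S g) * pmf \<mu> g) summable_on carrier G"

inductive_set semigroup_generate :: "('g, 'm) monoid_scheme \<Rightarrow> 'g set \<Rightarrow> 'g set"
  for G (structure) and A where
  incl: "a \<in> A \<Longrightarrow> a \<in> semigroup_generate G A"
| mult: "\<lbrakk>a \<in> semigroup_generate G A; b \<in> semigroup_generate G A\<rbrakk>
    \<Longrightarrow> a \<otimes> b \<in> semigroup_generate G A"

primrec group_walk :: "('g, 'm) monoid_scheme \<Rightarrow> (nat \<Rightarrow> 'g) \<Rightarrow> nat \<Rightarrow> 'g" where
  "group_walk G h 0 = one G"
| "group_walk G h (Suc n) = mult G (group_walk G h n) (h n)"

text \<open>A probability measure on the (countable, discrete) group is a pmf whose support lies in the
  carrier; \<open>h\<close> is an i.i.d. sequence of law \<open>\<mu>\<close> on the probability space \<open>M\<close>.\<close>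

definition iid_sequence :: "'w measure \<Rightarrow> 'g pmf \<Rightarrow> (nat \<Rightarrow> 'w \<Rightarrow> 'g) \<Rightarrow> bool" where
  "iid_sequence M \<mu> h \<longleftrightarrow> prob_space M \<and>
     prob_space.indep_vars M (\<lambda>_. count_space UNIV) h UNIV \<and>
     (\<forall>n. distr M (count_space UNIV) (h n) = measure_pmf \<mu>)"

end

theory Submission
  imports Defs
begin

text \<open>
  Let \<open>x n\<close> be the induced walk started at \<open>a\<close>, with \<open>x (n + 1) = x n . h n\<close>, and trace each step
  along a geodesic word of \<open>h n\<close>. If this trail misses a finite set \<open>K\<close>, the step stays within one
  component of \<open>X - K\<close>. Hence the walk converges to an end as soon as, for every finite \<open>K\<close>, almost
  surely only finitely many trails meet \<open>K\<close>. By the Borel--Cantelli lemma it suffices that the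
  expected number of such trails is finite. As \<open>h n\<close> is independent of \<open>x n\<close>, this number is the sum
  over \<open>x\<close> of \<open>N(a, x) \<mu>{g. the trail of g from x meets K}\<close>, where \<open>N(a, x)\<close> is the expected number
  of visits of the walk to \<open>x\<close>. Every letter permutes \<open>X\<close>, so the trails of one word \<open>w\<close> meet \<open>K\<close>
  from at most \<open>(|w| + 1) |K|\<close> starting points (\<open>card_trails_meeting\<close>). If \<open>N(a, x) \<le> C\<close> for all
  \<open>x\<close>, the expectation is therefore at most \<open>C |K|\<close> times the mean of \<open>|g| + 1\<close>, which is finite
  (\<open>AE_steps_eventually_avoid\<close>).

  The bound on \<open>N(a, x)\<close> (\<open>green_function_bounded\<close>) is a comparison of Dirichlet forms between a
  walk that need not be reversible and the simple random walk, in the spirit of Baldi, Lohoue and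
  Peyriere. Transience provides a function with values in \<open>[1, 2]\<close> that is superharmonic for the
  simple random walk, strictly at \<open>a\<close>, namely \<open>2\<close> minus the probability of never hitting \<open>a\<close>
  (\<open>transient_graph_superharmonic\<close>). The ground state inequality turns it into a capacity bound
  \<open>c w(a)\<^sup>2 \<le> \<Sum>s\<in>S. \<parallel>w - w.s\<parallel>\<^sup>2\<close> for all square summable \<open>w\<close>, where \<open>(w.g)(x) = w(x.g)\<close>
  (\<open>transient_capacity_bound\<close>).

  Stop the walk at an independent geometric time of parameter \<open>q\<close> and let \<open>\<rho>\<close> be its law, so that
  \<open>\<rho> / q\<close> is the Green function with discount \<open>1 - q\<close>. Counting measure is invariant under the group,
  and therefore pairing the equation \<open>\<rho> = q \<delta>\<^sub>a + (1 - q) \<rho> \<mu>\<close> with \<open>\<rho>\<close> gives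
  \<open>(1 - q) \<mu>(b) \<parallel>\<rho> - \<rho>.b\<parallel>\<^sup>2 \<le> 2 q \<rho>(a)\<close> for each \<open>b\<close> in the support of \<open>\<mu>\<close>. The squared displacement
  is subadditive under products up to a factor \<open>2\<close>, and the support generates the group as a
  semigroup, so the same bound holds for every \<open>s \<in> S\<close>, with another constant. Together with the
  capacity bound, \<open>\<rho>(a) \<le> C q / (1 - q)\<close>. By the maximum principle \<open>\<rho>\<close> is largest at \<open>a\<close>, and
  letting \<open>q\<close> tend to \<open>0\<close> bounds \<open>N(a, x)\<close> uniformly in \<open>x\<close>.
\<close>


section \<open>Chains driven by independent noise\<close>

text \<open>Both walks of this development are recursions fed with independent noise: for the walk induced by
  \<open>\<mu>\<close> the noise at time \<open>n\<close> is the increment \<open>h n\<close>, for a chain realised on \<open>markov_space\<close> it is the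
  whole row of choices \<open>\<omega> (n, x)\<close>. The step function may depend on the time, which makes it possible
  to start absorbing the chain at a given time.\<close>

primrec driven_chain :: "(nat \<Rightarrow> 'z \<Rightarrow> 'n \<Rightarrow> 'z) \<Rightarrow> 'z \<Rightarrow> (nat \<Rightarrow> 'n) \<Rightarrow> nat \<Rightarrow> 'z" where
  "driven_chain F z \<eta> 0 = z"
| "driven_chain F z \<eta> (Suc n) = F n (driven_chain F z \<eta> n) (\<eta> n)"

primrec chain_law :: "(nat \<Rightarrow> 'z \<Rightarrow> 'z pmf) \<Rightarrow> 'z \<Rightarrow> nat \<Rightarrow> 'z pmf" where
  "chain_law \<kappa> z 0 = return_pmf z"
| "chain_law \<kappa> z (Suc n) = bind_pmf (chain_law \<kappa> z n) (\<kappa> n)"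

lemma driven_chain_cong:
  "(\<And>k. k < n \<Longrightarrow> \<eta> k = \<eta>' k) \<Longrightarrow> driven_chain F z \<eta> n = driven_chain F z \<eta>' n"
  by (induction n) auto

text \<open>Countability of the state space \<open>Z\<close> is essential here: the step function is only known to be
  measurable in the noise for each fixed state, and the states are combined by a countable union.\<close>

lemma measurable_driven_chain_coordinates:
  assumes Z: "countable Z" "z0 \<in> Z"
    and F: "\<And>n z. z \<in> Z \<Longrightarrow> F n z \<in> measurable (N n) (count_space Z)"
    and "j \<le> n"
  shows "(\<lambda>\<eta>. driven_chain F z0 \<eta> j) \<in> measurable (PiM {..<n} N) (count_space Z)"
  using \<open>j \<le> n\<close>
proof (induction j)
  case 0
  then show ?case using Z by simp
next
  case (Suc j)
  have "(\<lambda>\<eta>. F j (driven_chain F z0 \<eta> j) (\<eta> j)) \<in> measurable (PiM {..<n} N) (count_space Z)"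
  proof (rule measurable_compose_countable'[where f="\<lambda>z \<eta>. F j z (\<eta> j)" and I=Z])
    show "(\<lambda>\<eta>. F j z (\<eta> j)) \<in> measurable (PiM {..<n} N) (count_space Z)" if "z \<in> Z" for z
      using Suc.prems by (intro measurable_compose[OF _ F[OF that, of j]] measurable_component_singleton) auto
    show "(\<lambda>\<eta>. driven_chain F z0 \<eta> j) \<in> measurable (PiM {..<n} N) (count_space Z)"
      using Suc by simp
  qed fact
  then show ?case by simp
qed

context prob_space
begin

text \<open>The state at time \<open>n\<close> depends on the noise before time \<open>n\<close> only, so it is independent of the noise at
  time \<open>n\<close>. This is the Markov property in the form in which it is used below.\<close>

lemma
  assumes \<xi>: "indep_vars N \<xi> UNIV"
    and Z: "countable Z" "z0 \<in> Z"
    and F: "\<And>n z. z \<in> Z \<Longrightarrow> F n z \<in> measurable (N n) (count_space Z)"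
  shows measurable_driven_chain:
      "(\<lambda>\<omega>. driven_chain F z0 (\<lambda>n. \<xi> n \<omega>) n) \<in> measurable M (count_space Z)"
    and prob_driven_chain_noise: "z \<in> Z \<Longrightarrow> B \<in> sets (N n) \<Longrightarrow>
      prob {\<omega> \<in> space M. driven_chain F z0 (\<lambda>n. \<xi> n \<omega>) n = z \<and> \<xi> n \<omega> \<in> B} =
      prob {\<omega> \<in> space M. driven_chain F z0 (\<lambda>n. \<xi> n \<omega>) n = z} *
      prob {\<omega> \<in> space M. \<xi> n \<omega> \<in> B}"
proof -
  let ?past = "\<lambda>\<omega>. restrict (\<lambda>k. \<xi> k \<omega>) {..<n}"
  let ?now = "\<lambda>\<omega>. restrict (\<lambda>k. \<xi> k \<omega>) {n}"
  let ?Y = "\<lambda>\<omega>. driven_chain F z0 (\<lambda>n. \<xi> n \<omega>) n"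
  have \<Psi>: "(\<lambda>\<eta>. driven_chain F z0 \<eta> n) \<in> measurable (PiM {..<n} N) (count_space Z)"
    by (rule measurable_driven_chain_coordinates[OF Z]) (use F in auto)
  have Y: "(\<lambda>\<eta>. driven_chain F z0 \<eta> n) \<circ> ?past = ?Y"
    by (auto simp: fun_eq_iff intro!: driven_chain_cong)
  have ind: "indep_var (PiM {..<n} N) ?past (PiM {n} N) ?now"
    by (rule indep_var_restrict[OF \<xi>]) auto
  have Ym: "(\<lambda>\<eta>. driven_chain F z0 \<eta> n) \<circ> ?past \<in> measurable M (count_space Z)"
    using measurable_comp[OF indep_var_rv1[OF ind] \<Psi>] .
  then show "?Y \<in> measurable M (count_space Z)"
    unfolding Y .
  show "prob {\<omega> \<in> space M. ?Y \<omega> = z \<and> \<xi> n \<omega> \<in> B} =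
      prob {\<omega> \<in> space M. ?Y \<omega> = z} * prob {\<omega> \<in> space M. \<xi> n \<omega> \<in> B}"
    if "z \<in> Z" "B \<in> sets (N n)"
  proof -
    let ?A = "(\<lambda>\<eta>. driven_chain F z0 \<eta> n) -` {z} \<inter> space (PiM {..<n} N)"
    let ?B = "(\<lambda>\<eta>. \<eta> n) -` B \<inter> space (PiM {n} N)"
    have A: "?A \<in> sets (PiM {..<n} N)"
      using \<Psi> by (rule measurable_sets) (use that in simp)
    have B: "?B \<in> sets (PiM {n} N)"
      using measurable_component_singleton[of n "{n}" N] that(2) by (auto intro: measurable_sets)
    have past: "?past \<omega> \<in> ?A \<longleftrightarrow> ?Y \<omega> = z" if "\<omega> \<in> space M" for \<omega>
      using measurable_space[OF indep_var_rv1[OF ind] that] fun_cong[OF Y, of \<omega>] by simp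
    have now: "?now \<omega> \<in> ?B \<longleftrightarrow> \<xi> n \<omega> \<in> B" if "\<omega> \<in> space M" for \<omega>
      using measurable_space[OF indep_var_rv2[OF ind] that] by simp
    have "(\<lambda>x. (?past x, ?now x)) -` (?A \<times> ?B) \<inter> space M = {\<omega> \<in> space M. ?Y \<omega> = z \<and> \<xi> n \<omega> \<in> B}"
      "?past -` ?A \<inter> space M = {\<omega> \<in> space M. ?Y \<omega> = z}"
      "?now -` ?B \<inter> space M = {\<omega> \<in> space M. \<xi> n \<omega> \<in> B}"
      using past now by blast+
    then show ?thesis
      using indep_varD[OF ind A B] by (simp only:)
  qed
qed

text \<open>The law of the driven chain is obtained by iterating its transition kernels, by conditioning on the
  previous state. It moves all computations from the given probability space to the monad of pmfs.\<close>

lemma prob_driven_chain: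
  assumes \<xi>: "indep_vars N \<xi> UNIV"
    and Z: "countable Z" "z0 \<in> Z"
    and F: "\<And>n z. z \<in> Z \<Longrightarrow> F n z \<in> measurable (N n) (count_space Z)"
    and \<kappa>: "\<And>n z y. z \<in> Z \<Longrightarrow> y \<in> Z \<Longrightarrow> prob {\<omega> \<in> space M. F n z (\<xi> n \<omega>) = y} = pmf (\<kappa> n z) y"
    and \<kappa>Z: "\<And>n z. z \<in> Z \<Longrightarrow> set_pmf (\<kappa> n z) \<subseteq> Z"
    and "y \<in> Z"
  shows "prob {\<omega> \<in> space M. driven_chain F z0 (\<lambda>n. \<xi> n \<omega>) n = y} = pmf (chain_law \<kappa> z0 n) y"
  using \<open>y \<in> Z\<close>
proof (induction n arbitrary: y)
  case 0
  then show ?case by (auto simp: prob_space indicator_def)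
next
  case (Suc n)
  let ?Y = "\<lambda>n \<omega>. driven_chain F z0 (\<lambda>n. \<xi> n \<omega>) n"
  have Ym: "?Y k \<in> measurable M (count_space Z)" for k
    by (rule measurable_driven_chain[OF \<xi> Z]) (use F in auto)
  have \<xi>m[measurable]: "\<xi> k \<in> measurable M (N k)" for k
    using \<xi> by (auto simp: indep_vars_def)
  have Fm: "F n z -` {y} \<inter> space (N n) \<in> sets (N n)" if "z \<in> Z" for z
    using measurable_sets[OF F[OF that, of n], of "{y}"] Suc.prems by simp
  have law_Z: "set_pmf (chain_law \<kappa> z0 k) \<subseteq> Z" for k
    using Z(2) \<kappa>Z by (induction k) auto
  let ?E = "\<lambda>z. {\<omega> \<in> space M. ?Y n \<omega> = z \<and> \<xi> n \<omega> \<in> F n z -` {y} \<inter> space (N n)}"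
  have Esets: "?E z \<in> sets M" if "z \<in> Z" for z
  proof -
    have "{\<omega> \<in> space M. ?Y n \<omega> = z} \<in> sets M"
      using measurable_sets[OF Ym, of "{z}" n] that
      by (simp add: vimage_def Int_def conj_commute)
    moreover have "{\<omega> \<in> space M. \<xi> n \<omega> \<in> F n z -` {y} \<inter> space (N n)} \<in> sets M"
      using measurable_sets[OF \<xi>m Fm[OF that]] by (simp add: vimage_def Int_def conj_ac)
    ultimately have "{\<omega> \<in> space M. ?Y n \<omega> = z} \<inter> {\<omega> \<in> space M. \<xi> n \<omega> \<in> F n z -` {y} \<inter> space (N n)} \<in> sets M"
      by (rule sets.Int)
    also have "{\<omega> \<in> space M. ?Y n \<omega> = z} \<inter> {\<omega> \<in> space M. \<xi> n \<omega> \<in> F n z -` {y} \<inter> space (N n)} = ?E z"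
      by blast
    finally show ?thesis .
  qed
  have YZ: "?Y n \<omega> \<in> Z" if "\<omega> \<in> space M" for \<omega>
    using measurable_space[OF Ym that] by simp
  have E: "{\<omega> \<in> space M. ?Y (Suc n) \<omega> = y} = (\<Union>z\<in>Z. ?E z)"
    using YZ measurable_space[OF \<xi>m] by auto
  have prE: "prob (?E z) = pmf (chain_law \<kappa> z0 n) z * pmf (\<kappa> n z) y" if "z \<in> Z" for z
  proof -
    have "prob (?E z) = prob {\<omega> \<in> space M. ?Y n \<omega> = z} * prob {\<omega> \<in> space M. \<xi> n \<omega> \<in> F n z -` {y} \<inter> space (N n)}"
      by (rule prob_driven_chain_noise[OF \<xi> Z _ that Fm[OF that]]) (use F in auto)
    also have "{\<omega> \<in> space M. \<xi> n \<omega> \<in> F n z -` {y} \<inter> space (N n)} = {\<omega> \<in> space M. F n z (\<xi> n \<omega>) = y}"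
      using measurable_space[OF \<xi>m] by auto
    finally show ?thesis
      using Suc.IH[OF that] \<kappa>[OF that Suc.prems] by simp
  qed
  have "emeasure M {\<omega> \<in> space M. ?Y (Suc n) \<omega> = y} = (\<integral>\<^sup>+z. emeasure M (?E z) \<partial>count_space Z)"
    unfolding E by (rule emeasure_UN_countable[OF Esets Z(1)]) (auto simp: disjoint_family_on_def)
  also have "\<dots> = (\<integral>\<^sup>+z. ennreal (pmf (chain_law \<kappa> z0 n) z) * ennreal (pmf (\<kappa> n z) y) \<partial>count_space Z)"
    by (intro nn_integral_cong) (auto simp only: emeasure_eq_measure prE space_count_space ennreal_mult pmf_nonneg)
  also have "\<dots> = (\<integral>\<^sup>+z. ennreal (pmf (chain_law \<kappa> z0 n) z) * ennreal (pmf (\<kappa> n z) y) \<partial>count_space UNIV)"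
    using law_Z[of n] by (intro nn_integral_count_space_eq) (auto simp: set_pmf_iff)
  also have "\<dots> = (\<integral>\<^sup>+z. ennreal (pmf (\<kappa> n z) y) \<partial>measure_pmf (chain_law \<kappa> z0 n))"
    by (subst nn_integral_measure_pmf) simp
  also have "\<dots> = ennreal (pmf (chain_law \<kappa> z0 (Suc n)) y)"
    by (simp add: ennreal_pmf_bind)
  finally show ?case
    by (simp add: emeasure_eq_measure pmf_nonneg)
qed

end


section \<open>A strictly superharmonic function on a transient graph\<close>

lemma integrable_pmf_bounded:
  fixes g :: "'a \<Rightarrow> real"
  assumes "\<And>x. 0 \<le> g x" "\<And>x. g x \<le> B"
  shows "integrable (measure_pmf p) g"
  using assms by (intro measure_pmf.integrable_const_bound[where B=B]) auto

lemma expectation_bind_pmf: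
  fixes g :: "'b \<Rightarrow> real"
  assumes g: "\<And>x. 0 \<le> g x" "\<And>x. g x \<le> B"
  shows "measure_pmf.expectation (bind_pmf p f) g =
    measure_pmf.expectation p (\<lambda>x. measure_pmf.expectation (f x) g)"
proof -
  have le: "measure_pmf.expectation (f x) g \<le> B" for x
    by (rule measure_pmf.integral_le_const) (auto intro: integrable_pmf_bounded g)
  have "ennreal (measure_pmf.expectation (bind_pmf p f) g) = (\<integral>\<^sup>+x. ennreal (g x) \<partial>bind_pmf p f)"
    by (rule nn_integral_eq_integral[symmetric]) (auto intro: integrable_pmf_bounded g)
  also have "\<dots> = (\<integral>\<^sup>+x. ennreal (measure_pmf.expectation (f x) g) \<partial>p)"
    by (simp, intro nn_integral_cong nn_integral_eq_integral) (auto intro: integrable_pmf_bounded g)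
  also have "\<dots> = ennreal (measure_pmf.expectation p (\<lambda>x. measure_pmf.expectation (f x) g))"
    by (rule nn_integral_eq_integral) (auto intro!: integrable_pmf_bounded[where B=B] le g Bochner_Integration.integral_nonneg)
  finally show ?thesis
    using g by (subst (asm) ennreal_inj) auto
qed

lemma chain_law_add:
  "chain_law \<kappa> z (m + n) = bind_pmf (chain_law \<kappa> z m) (\<lambda>y. chain_law (\<lambda>k. \<kappa> (m + k)) y n)"
  by (induction n) (auto simp: bind_return_pmf' bind_assoc_pmf)

lemma chain_law_cong:
  "(\<And>k. k < n \<Longrightarrow> \<kappa> k = \<kappa>' k) \<Longrightarrow> chain_law \<kappa> z n = chain_law \<kappa>' z n"
  by (induction n) auto

text \<open>Absorption turns avoidance of \<open>a\<close> during a time interval into a statement about a single time: the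
  chain has not visited \<open>a\<close> up to time \<open>n\<close> iff the absorbed chain is not at \<open>a\<close> at time \<open>n\<close>.\<close>

definition absorbed_at :: "'x \<Rightarrow> ('x \<Rightarrow> 'x pmf) \<Rightarrow> 'x \<Rightarrow> 'x pmf" where
  "absorbed_at a K x = (if x = a then return_pmf a else K x)"

definition avoid_prob :: "('x \<Rightarrow> 'x pmf) \<Rightarrow> 'x \<Rightarrow> nat \<Rightarrow> 'x \<Rightarrow> real" where
  "avoid_prob K a n x = measure_pmf.prob (chain_law (\<lambda>_. absorbed_at a K) x n) (- {a})"

lemma avoid_prob_bounds: "0 \<le> avoid_prob K a n x" "avoid_prob K a n x \<le> 1"
  by (auto simp: avoid_prob_def)

lemma prob_chain_law_add:
  "measure_pmf.prob (chain_law \<kappa> x (m + n)) B =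
    measure_pmf.expectation (chain_law \<kappa> x m)
      (\<lambda>y. measure_pmf.prob (chain_law (\<lambda>k. \<kappa> (m + k)) y n) B)"
  using expectation_bind_pmf[of "indicator B" 1 "chain_law \<kappa> x m" "\<lambda>y. chain_law (\<lambda>k. \<kappa> (m + k)) y n"]
  by (simp add: chain_law_add)

lemma avoid_prob_target: "avoid_prob K a n a = 0"
proof -
  have "chain_law (\<lambda>_. absorbed_at a K) a n = return_pmf a"
    by (induction n) (auto simp: absorbed_at_def bind_return_pmf)
  then show ?thesis by (simp add: avoid_prob_def indicator_def)
qed

lemma avoid_prob_Suc:
  assumes "x \<noteq> a"
  shows "avoid_prob K a (Suc n) x = measure_pmf.expectation (K x) (avoid_prob K a n)"
  using prob_chain_law_add[of "\<lambda>_. absorbed_at a K" x 1 n "- {a}"] assms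
  by (simp add: avoid_prob_def[abs_def] absorbed_at_def bind_return_pmf)

lemma avoid_prob_decreasing: "avoid_prob K a (Suc n) x \<le> avoid_prob K a n x"
proof (induction n arbitrary: x)
  case 0
  show ?case
  proof (cases "x = a")
    case False
    then have "avoid_prob K a 0 x = 1" by (simp add: avoid_prob_def indicator_def)
    then show ?thesis using avoid_prob_bounds(2)[of K a "Suc 0" x] by simp
  qed (simp add: avoid_prob_target)
next
  case (Suc n)
  show ?case
  proof (cases "x = a")
    case False
    show ?thesis
      unfolding avoid_prob_Suc[OF False]
      by (intro integral_mono integrable_pmf_bounded[where B=1] avoid_prob_bounds Suc)
  qed (simp add: avoid_prob_target)
qed

text \<open>The probability of never hitting \<open>a\<close>, obtained as the limit of the decreasing avoidance
  probabilities. It is harmonic away from \<open>a\<close> and vanishes at \<open>a\<close>.\<close>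

definition avoid_forever :: "('x \<Rightarrow> 'x pmf) \<Rightarrow> 'x \<Rightarrow> 'x \<Rightarrow> real" where
  "avoid_forever K a x = lim (\<lambda>n. avoid_prob K a n x)"

lemma avoid_prob_tendsto: "(\<lambda>n. avoid_prob K a n x) \<longlonglongrightarrow> avoid_forever K a x"
proof -
  have "decseq (\<lambda>n. avoid_prob K a n x)"
    by (rule decseq_SucI) (rule avoid_prob_decreasing)
  then obtain L where "(\<lambda>n. avoid_prob K a n x) \<longlonglongrightarrow> L"
    by (rule decseq_convergent[where B=0]) (auto simp: avoid_prob_bounds)
  then show ?thesis
    by (simp add: avoid_forever_def limI)
qed

lemma expectation_avoid_prob_tendsto:
  "(\<lambda>n. measure_pmf.expectation p (avoid_prob K a n)) \<longlonglongrightarrow> measure_pmf.expectation p (avoid_forever K a)"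
  by (rule integral_dominated_convergence[where w="\<lambda>_. 1"])
     (auto simp: avoid_prob_bounds intro!: avoid_prob_tendsto)

lemma avoid_forever_bounds: "0 \<le> avoid_forever K a x" "avoid_forever K a x \<le> 1"
  by (auto intro!: LIMSEQ_le_const[OF avoid_prob_tendsto] LIMSEQ_le_const2[OF avoid_prob_tendsto]
      simp: avoid_prob_bounds)

lemma avoid_forever_target: "avoid_forever K a a = 0"
  using avoid_prob_tendsto[of K a a] by (simp add: avoid_prob_target LIMSEQ_const_iff)

lemma avoid_forever_harmonic:
  assumes "x \<noteq> a"
  shows "measure_pmf.expectation (K x) (avoid_forever K a) = avoid_forever K a x"
  using LIMSEQ_unique[OF expectation_avoid_prob_tendsto[of "K x" K a]
      LIMSEQ_Suc[OF avoid_prob_tendsto[of K a x], unfolded avoid_prob_Suc[OF assms]]] .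

text \<open>If the average of \<open>avoid_forever K a\<close> over the first step from \<open>a\<close> vanishes, this function is
  harmonic at \<open>a\<close> as well. Its expectation then stays constant along the chain, at its value \<open>0\<close> at
  the starting point.\<close>

lemma expectation_avoid_forever_zero:
  assumes "measure_pmf.expectation (K a) (avoid_forever K a) = 0"
  shows "measure_pmf.expectation (chain_law (\<lambda>_. K) a m) (avoid_forever K a) = 0"
proof (induction m)
  case 0
  then show ?case by (simp add: avoid_forever_target)
next
  case (Suc m)
  have "measure_pmf.expectation (K x) (avoid_forever K a) = avoid_forever K a x" for x
    using assms avoid_forever_harmonic[of x a K] by (cases "x = a") (auto simp: avoid_forever_target)
  then show ?case
    using Suc by (simp add: expectation_bind_pmf[OF avoid_forever_bounds])
qed

text \<open>In that case the chain started at \<open>a\<close>, run freely up to time \<open>m\<close> and absorbed at \<open>a\<close> from then on,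
  is absorbed almost surely: in other words, the chain visits \<open>a\<close> at or after time \<open>m\<close>.\<close>

lemma return_after_tendsto:
  assumes "measure_pmf.expectation (K a) (avoid_forever K a) = 0"
  shows "(\<lambda>n. pmf (chain_law (\<lambda>k. if k < m then K else absorbed_at a K) a (m + n)) a) \<longlonglongrightarrow> 1"
proof -
  let ?\<kappa> = "\<lambda>k. if k < m then K else absorbed_at a K"
  have "measure_pmf.prob (chain_law ?\<kappa> a (m + n)) (- {a}) =
    measure_pmf.expectation (chain_law (\<lambda>_. K) a m) (avoid_prob K a n)" for n
    unfolding prob_chain_law_add using chain_law_cong[of m ?\<kappa> "\<lambda>_. K" a]
    by (simp add: avoid_prob_def[abs_def])
  moreover have "measure_pmf.prob p (- {a}) = 1 - pmf p a" for p
    using measure_pmf.prob_compl[of "{a}" p] by (simp add: measure_pmf_single Compl_eq_Diff_UNIV)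
  ultimately have "(\<lambda>n. 1 - pmf (chain_law ?\<kappa> a (m + n)) a) \<longlonglongrightarrow> 0"
    using expectation_avoid_prob_tendsto[of "chain_law (\<lambda>_. K) a m" K a]
    by (simp add: expectation_avoid_forever_zero[OF assms])
  from tendsto_diff[OF tendsto_const[of 1] this] show ?thesis by simp
qed

lemma prob_space_markov_space: "prob_space (markov_space K)"
  unfolding markov_space_def by (rule prob_space_PiM) (auto split: prod.split simp: prob_space_measure_pmf)

text \<open>The coordinates of a product space are independent, and so are the rows, being disjoint blocks of
  coordinates.\<close>

lemma indep_vars_markov_rows:
  "prob_space.indep_vars (markov_space K)
     (\<lambda>n. PiM ({n} \<times> UNIV) (\<lambda>(n, x). measure_pmf (K x)))
     (\<lambda>n \<omega>. restrict \<omega> ({n} \<times> UNIV)) UNIV"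
proof -
  interpret P: prob_space "markov_space K" by (rule prob_space_markov_space)
  let ?M = "\<lambda>(n, x). measure_pmf (K x)"
  have prob: "prob_space (?M i)" for i by (auto split: prod.split simp: prob_space_measure_pmf)
  have "P.indep_vars ?M (\<lambda>i \<omega>. \<omega> i) UNIV"
  proof (subst P.indep_vars_iff_distr_eq_PiM)
    show "(\<lambda>\<omega>. \<omega> i) \<in> measurable (markov_space K) (?M i)" for i
      unfolding markov_space_def by (rule measurable_component_singleton) simp
    have "distr (markov_space K) (PiM UNIV ?M) (\<lambda>x. \<lambda>i\<in>UNIV. x i) = markov_space K"
      unfolding markov_space_def by (simp add: restrict_UNIV distr_id)
    also have "\<dots> = (\<Pi>\<^sub>M i\<in>UNIV. distr (markov_space K) (?M i) (\<lambda>\<omega>. \<omega> i))"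
      unfolding markov_space_def
      by (intro PiM_cong refl distr_PiM_component[symmetric] prob UNIV_I)
    finally show "distr (markov_space K) (PiM UNIV ?M) (\<lambda>x. \<lambda>i\<in>UNIV. x i) = \<dots>" .
  qed simp
  from P.indep_vars_restrict[OF this, of UNIV "\<lambda>n. {n} \<times> UNIV"]
  show ?thesis
    by (auto simp: disjoint_family_on_def)
qed

lemma prob_markov_choice:
  "measure (markov_space K) {\<omega> \<in> space (markov_space K). \<omega> (n, x) \<in> B} = measure_pmf.prob (K x) B"
proof -
  let ?M = "\<lambda>(n, x). measure_pmf (K x)"
  have prob: "prob_space (?M i)" for i by (auto split: prod.split simp: prob_space_measure_pmf)
  have m: "(\<lambda>\<omega>. \<omega> (n, x)) \<in> measurable (markov_space K) (?M (n, x))"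
    unfolding markov_space_def by (rule measurable_component_singleton) simp
  have "measure_pmf.prob (K x) B = measure (distr (markov_space K) (?M (n, x)) (\<lambda>\<omega>. \<omega> (n, x))) B"
    unfolding markov_space_def by (subst distr_PiM_component[OF prob UNIV_I]) simp
  also have "\<dots> = measure (markov_space K) {\<omega> \<in> space (markov_space K). \<omega> (n, x) \<in> B}"
    using m by (subst measure_distr) (auto intro!: arg_cong[where f="measure _"])
  finally show ?thesis ..
qed

lemma AE_markov_choice_closed:
  assumes "countable X" "\<And>x. x \<in> X \<Longrightarrow> set_pmf (K x) \<subseteq> X"
  shows "AE \<omega> in markov_space K. \<forall>n. \<forall>x\<in>X. \<omega> (n, x) \<in> X"
proof -
  have "AE \<omega> in markov_space K. \<omega> (n, x) \<in> X" if "x \<in> X" for n x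
    unfolding markov_space_def
    by (rule AE_PiM_component[where i="(n, x)" and P="\<lambda>y. y \<in> X"])
       (use assms(2)[OF that] in \<open>auto split: prod.split simp: prob_space_measure_pmf AE_measure_pmf_iff\<close>)
  then show ?thesis
    using assms(1) by (auto simp: AE_all_countable AE_ball_countable)
qed

text \<open>For each \<open>m\<close> the path is coupled with the chain that uses the same choices but is absorbed at \<open>a\<close>
  from time \<open>m\<close> on. The two agree until the first visit to \<open>a\<close> at or after time \<open>m\<close>, and the absorbed
  chain reaches \<open>a\<close> almost surely; hence so does the path, for every \<open>m\<close>. The absorbed chain
  resets to \<open>a\<close> whenever a choice leaves \<open>X\<close>: this has probability \<open>0\<close>, and it keeps the chain in a
  countable set everywhere, as measurability requires.\<close>

lemma AE_markov_path_recurrent: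
  assumes X: "countable X" "a \<in> X" and KX: "\<And>x. x \<in> X \<Longrightarrow> set_pmf (K x) \<subseteq> X"
    and zero: "measure_pmf.expectation (K a) (avoid_forever K a) = 0"
  shows "AE \<omega> in markov_space K. infinite {n. markov_path a \<omega> n = a}"
proof -
  interpret P: prob_space "markov_space K" by (rule prob_space_markov_space)
  let ?\<xi> = "\<lambda>n \<omega>. restrict \<omega> ({n::nat} \<times> UNIV)"
  let ?N = "\<lambda>n. PiM ({n} \<times> UNIV) (\<lambda>(n, x). measure_pmf (K x))"
  let ?c = "\<lambda>y. if y \<in> X then y else a"
  (* ?c is the reset into X, ?F m the step of the chain that is absorbed at a from time m on. *)
  let ?F = "\<lambda>m n z \<eta>. if m \<le> n \<and> z = a then a else ?c (\<eta> (n, z))"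
  let ?\<kappa> = "\<lambda>m k. if k < m then K else absorbed_at a K"
  let ?Y = "\<lambda>m n \<omega>. driven_chain (?F m) a (\<lambda>n. ?\<xi> n \<omega>) n"
  have F: "?F m n z \<in> measurable (?N n) (count_space X)" if "z \<in> X" for m n z
  proof -
    have "(\<lambda>\<eta>. ?c (\<eta> (n, z))) \<in> measurable (?N n) (count_space X)"
      by (rule measurable_compose[OF measurable_component_singleton[of "(n, z)" "{n} \<times> UNIV"]]) (use X in auto)
    then show ?thesis using X by simp
  qed
  have \<kappa>: "P.prob {\<omega> \<in> space (markov_space K). ?F m n z (?\<xi> n \<omega>) = y} = pmf (?\<kappa> m n z) y"
    if "z \<in> X" "y \<in> X" for m n z y
  proof (cases "m \<le> n \<and> z = a")
    case True
    then show ?thesis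
      by (cases "y = a") (auto simp: absorbed_at_def P.prob_space)
  next
    case False
    have "P.prob {\<omega> \<in> space (markov_space K). ?F m n z (?\<xi> n \<omega>) = y} =
      measure_pmf.prob (K z) {x. ?c x = y}"
      unfolding prob_markov_choice[of K n z "{x. ?c x = y}", symmetric]
      using False by (intro arg_cong[where f=P.prob]) auto
    also have "\<dots> = measure_pmf.prob (K z) {y}"
      using KX[OF \<open>z \<in> X\<close>] that by (intro measure_eq_AE) (auto simp: AE_measure_pmf_iff)
    finally show ?thesis
      using False by (auto simp: absorbed_at_def measure_pmf_single)
  qed
  have ret: "AE \<omega> in markov_space K. \<exists>n. ?Y m (m + n) \<omega> = a" for m
  proof -
    have Ym: "?Y m n \<in> measurable (markov_space K) (count_space X)" for n
      by (rule P.measurable_driven_chain[OF indep_vars_markov_rows X]) (rule F)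
    have Y: "{\<omega> \<in> space (markov_space K). ?Y m n \<omega> = a} \<in> P.events" for n
      using measurable_sets[OF Ym, of "{a}" n] X by (simp add: vimage_def Int_def conj_commute)
    have law: "P.prob {\<omega> \<in> space (markov_space K). ?Y m n \<omega> = a} = pmf (chain_law (?\<kappa> m) a n) a" for n
      by (rule P.prob_driven_chain[OF indep_vars_markov_rows X])
         (use F \<kappa> KX X in \<open>auto simp: absorbed_at_def\<close>)
    let ?B = "\<Union>n. {\<omega> \<in> space (markov_space K). ?Y m (m + n) \<omega> = a}"
    have "1 \<le> P.prob ?B"
    proof (rule LIMSEQ_le_const2[OF return_after_tendsto[OF zero, of m]], intro exI[of _ 0] allI impI)
      fix n
      show "pmf (chain_law (?\<kappa> m) a (m + n)) a \<le> P.prob ?B"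
        unfolding law[symmetric] using Y by (intro P.finite_measure_mono) auto
    qed
    then have "P.prob ?B = 1" by (simp add: antisym)
    then have "AE \<omega> in markov_space K. \<omega> \<in> ?B"
      using Y by (intro P.AE_prob_1) auto
    then show ?thesis by auto
  qed
  have "AE \<omega> in markov_space K. (\<forall>m. \<exists>n. ?Y m (m + n) \<omega> = a) \<and> (\<forall>n. \<forall>x\<in>X. \<omega> (n, x) \<in> X)"
    using ret AE_markov_choice_closed[OF X(1) KX] by (simp add: AE_all_countable)
  then show ?thesis
  proof eventually_elim
    case (elim \<omega>)
    have path: "markov_path a \<omega> n \<in> X" for n
      using elim X by (induction n) auto
    have eq: "?Y m n \<omega> = markov_path a \<omega> n"
      if "\<And>k. m \<le> k \<Longrightarrow> k < n \<Longrightarrow> markov_path a \<omega> k \<noteq> a" for m n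
      using that
    proof (induction n)
      case (Suc n)
      have IH: "?Y m n \<omega> = markov_path a \<omega> n"
        by (rule Suc.IH) (use Suc.prems in auto)
      show ?case
        unfolding driven_chain.simps IH using Suc.prems[of n] path[of "Suc n"] by auto
    qed simp
    have "\<exists>n\<ge>m. markov_path a \<omega> n = a" for m
    proof (rule ccontr)
      assume neg: "\<not> (\<exists>n\<ge>m. markov_path a \<omega> n = a)"
      obtain n where "?Y m (m + n) \<omega> = a" using elim by blast
      then show False
        using eq[of m "m + n"] neg le_add1[of m n] by metis
    qed
    then show ?case
      by (simp add: infinite_nat_iff_unbounded_le)
  qed
qed

text \<open>With \<open>r\<close> the probability of never hitting \<open>a\<close>, the function \<open>2 - r\<close> is harmonic away from \<open>a\<close>, and at
  \<open>a\<close> it is superharmonic because \<open>r\<close> is minimal there. If the inequality at \<open>a\<close> were an equality,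
  the simple random walk would return to \<open>a\<close> infinitely often. The constant \<open>2\<close> keeps the function
  away from \<open>0\<close>, so that one may divide by it.\<close>

lemma transient_graph_superharmonic:
  assumes trans: "transient_graph X A" and X: "countable X" "a \<in> X"
    and A: "A \<subseteq> X \<times> X" and fin: "\<And>x. finite (A `` {x})"
  obtains f :: "'x \<Rightarrow> real" where "\<And>x. 1 \<le> f x" "\<And>x. f x \<le> 2"
    "\<And>x. 0 \<le> (\<Sum>y\<in>A `` {x}. f x - f y)" "0 < (\<Sum>y\<in>A `` {a}. f a - f y)"
proof
  let ?K = "srw_kernel A"
  define r where "r = avoid_forever ?K a"
  interpret P: prob_space "markov_space ?K" by (rule prob_space_markov_space)
  have r: "0 \<le> r x" "r x \<le> 1" for x
    by (simp_all add: r_def avoid_forever_bounds)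
  show "1 \<le> 2 - r x" "2 - r x \<le> 2" for x
    using r[of x] by auto
  have KX: "set_pmf (?K x) \<subseteq> X" if "x \<in> X" for x
    using A that fin[of x] by (auto simp: srw_kernel_def)
  have K: "(\<Sum>y\<in>A `` {x}. r y) = card (A `` {x}) * measure_pmf.expectation (?K x) r"
    if "A `` {x} \<noteq> {}" for x
    using fin[of x] that by (simp add: srw_kernel_def integral_pmf_of_set)
  have sum: "(\<Sum>y\<in>A `` {x}. (2 - r x) - (2 - r y)) = (\<Sum>y\<in>A `` {x}. r y) - card (A `` {x}) * r x" for x
    by (simp add: sum_subtractf)
  show "0 \<le> (\<Sum>y\<in>A `` {x}. (2 - r x) - (2 - r y))" for x
  proof (cases "x = a \<or> A `` {x} = {}")
    case True
    then show ?thesis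
      unfolding sum using r by (auto simp: sum_nonneg r_def avoid_forever_target)
  next
    case False
    then show ?thesis
      unfolding sum using K[of x] avoid_forever_harmonic[of x a ?K] by (simp add: r_def)
  qed
  have "\<not> (AE \<omega> in markov_space ?K. infinite {n. markov_path a \<omega> n = a})"
  proof
    assume "AE \<omega> in markov_space ?K. infinite {n. markov_path a \<omega> n = a}"
    moreover have "AE \<omega> in markov_space ?K. finite {n. markov_path a \<omega> n = a}"
      using trans X by (simp add: transient_graph_def)
    ultimately have "AE \<omega> in markov_space ?K. False" by eventually_elim auto
    then show False by simp
  qed
  then have "measure_pmf.expectation (?K a) r \<noteq> 0"
    using AE_markov_path_recurrent[OF X KX] by (auto simp: r_def)
  moreover have "measure_pmf.expectation (?K a) r \<ge> 0"
    using r by simp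
  moreover have "A `` {a} \<noteq> {}"
    using calculation by (auto simp: srw_kernel_def r_def avoid_forever_target)
  ultimately show "0 < (\<Sum>y\<in>A `` {a}. (2 - r a) - (2 - r y))"
    unfolding sum using K[of a] fin[of a] by (simp add: r_def avoid_forever_target card_gt_0_iff)
qed


section \<open>Capacity and displacement energy\<close>

text \<open>The difference of the two sides is the square \<open>(u q - v p)\<^sup>2 / (p q)\<close>.\<close>

lemma ground_state_pointwise:
  fixes u v p q :: real
  assumes "0 < p" "0 < q"
  shows "(u\<^sup>2 / p - v\<^sup>2 / q) * (p - q) \<le> (u - v)\<^sup>2"
proof -
  have "(u - v)\<^sup>2 - (u\<^sup>2 / p - v\<^sup>2 / q) * (p - q) = (u * q - v * p)\<^sup>2 / (p * q)"
    using assms by (simp add: field_simps power2_eq_square)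
  moreover have "0 \<le> (u * q - v * p)\<^sup>2 / (p * q)"
    using assms by simp
  ultimately show ?thesis by linarith
qed

lemma summable_on_diff_squares:
  fixes u v :: "'a \<Rightarrow> real"
  assumes "(\<lambda>x. (u x)\<^sup>2) summable_on B" "(\<lambda>x. (v x)\<^sup>2) summable_on B"
  shows "(\<lambda>x. (u x - v x)\<^sup>2) summable_on B"
proof (rule summable_on_comparison_test)
  show "(\<lambda>x. 2 * ((u x)\<^sup>2 + (v x)\<^sup>2)) summable_on B"
    by (intro summable_on_cmult_right summable_on_add assms)
  show "(u x - v x)\<^sup>2 \<le> 2 * ((u x)\<^sup>2 + (v x)\<^sup>2)" for x
    using zero_le_power2[of "u x + v x"] by (simp add: power2_eq_square algebra_simps)
qed simp

lemma has_sum_finite_sum: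
  fixes f :: "'s \<Rightarrow> 'a \<Rightarrow> 'b::topological_comm_monoid_add"
  assumes "\<And>s. s \<in> S \<Longrightarrow> (f s has_sum c s) B"
  shows "((\<lambda>x. \<Sum>s\<in>S. f s x) has_sum (\<Sum>s\<in>S. c s)) B"
  using assms
proof (induction S rule: infinite_finite_induct)
  case (insert s S)
  then show ?case by (simp add: has_sum_add)
qed simp_all

text \<open>The ground state inequality: test the superharmonicity of \<open>f\<close> against \<open>w\<^sup>2 / f\<close>. Summation by parts
  over the edges produces the products bounded in \<open>ground_state_pointwise\<close>, hence at most half of
  the Dirichlet energy of \<open>w\<close>; all terms on the vertex side are nonnegative, and the one at \<open>a\<close> is at
  least half of the left-hand side since \<open>f a \<le> 2\<close>. The bounds on \<open>f\<close> and on the degrees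
  make all sums converge absolutely for square summable \<open>w\<close>.\<close>

lemma superharmonic_capacity_bound:
  fixes f w :: "'x \<Rightarrow> real"
  assumes A: "A \<subseteq> X \<times> X" "sym A" and a: "a \<in> X"
    and deg: "\<And>x. finite (A `` {x})" "\<And>x. card (A `` {x}) \<le> D"
    and f: "\<And>x. 1 \<le> f x" "\<And>x. f x \<le> 2" "\<And>x. 0 \<le> (\<Sum>y\<in>A `` {x}. f x - f y)"
    and w: "(\<lambda>x. (w x)\<^sup>2) summable_on X"
  shows "(\<lambda>(x, y). (w x - w y)\<^sup>2) summable_on A"
    and "(\<Sum>y\<in>A `` {a}. f a - f y) * (w a)\<^sup>2 \<le> infsum (\<lambda>(x, y). (w x - w y)\<^sup>2) A"
proof -
  let ?\<phi> = "\<lambda>x. (w x)\<^sup>2 / f x"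
  let ?t = "\<lambda>(x, y). ?\<phi> x * (f x - f y)"
  have Sigma: "A = Sigma X (\<lambda>x. A `` {x})"
    using A by auto
  have swap: "bij_betw prod.swap A A"
    using \<open>sym A\<close> by (auto intro!: bij_betwI[where g=prod.swap] dest: symD)
  have f_pos: "0 < f x" for x
    using f(1)[of x] by simp
  have w1: "(\<lambda>(x, y). (w x)\<^sup>2) summable_on A"
  proof (subst Sigma, rule summable_on_SigmaI)
    show "((\<lambda>y. case (x, y) of (x, y) \<Rightarrow> (w x)\<^sup>2) has_sum (card (A `` {x}) * (w x)\<^sup>2)) (A `` {x})" for x
      using has_sum_finite[OF deg(1)[of x], of "\<lambda>y. (w x)\<^sup>2"] by simp
    show "(\<lambda>x. card (A `` {x}) * (w x)\<^sup>2) summable_on X"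
      by (rule summable_on_comparison_test[OF summable_on_cmult_right[OF w, of D]])
         (auto intro!: mult_right_mono deg)
  qed auto
  then have w2: "(\<lambda>(x, y). (w y)\<^sup>2) summable_on A"
    using summable_on_reindex_bij_betw[OF swap, of "\<lambda>(x, y). (w x)\<^sup>2"] by (simp add: case_prod_unfold)
  show sq: "(\<lambda>(x, y). (w x - w y)\<^sup>2) summable_on A"
    using summable_on_diff_squares[of "\<lambda>(x, y). w x" A "\<lambda>(x, y). w y"] w1 w2
    by (simp add: case_prod_unfold)
  have t_bound: "\<bar>?\<phi> x * (f x - f y)\<bar> \<le> (w x)\<^sup>2" for x y
  proof -
    have "\<bar>f x - f y\<bar> \<le> f x"
      using f(1)[of x] f(2)[of x] f(1)[of y] f(2)[of y] by linarith
    then have "\<bar>f x - f y\<bar> / f x \<le> 1"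
      using f_pos by simp
    from mult_left_mono[OF this, of "(w x)\<^sup>2"] show ?thesis
      using f_pos[of x] by (simp add: abs_mult)
  qed
  have t: "?t summable_on A"
    by (rule summable_on_iff_abs_summable_on_real[THEN iffD2], rule summable_on_comparison_test[OF w1])
       (use t_bound in auto)
  have t': "(\<lambda>(x, y). ?\<phi> y * (f y - f x)) summable_on A"
    using summable_on_reindex_bij_betw[OF swap, of ?t] t by (simp add: case_prod_unfold)
  have inner: "infsum (\<lambda>y. ?t (x, y)) (A `` {x}) = ?\<phi> x * (\<Sum>y\<in>A `` {x}. f x - f y)" for x
    using deg(1)[of x] by (simp add: sum_distrib_left)
  have tS: "?t summable_on Sigma X (\<lambda>x. A `` {x})"
    using t unfolding Sigma[symmetric] .
  have outer: "infsum ?t A = infsum (\<lambda>x. ?\<phi> x * (\<Sum>y\<in>A `` {x}. f x - f y)) X"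
    using infsum_Sigma_banach[OF tS] unfolding inner Sigma[symmetric] ..
  have outer_summable: "(\<lambda>x. ?\<phi> x * (\<Sum>y\<in>A `` {x}. f x - f y)) summable_on X"
    using summable_on_Sigma_banach[of "\<lambda>x y. ?t (x, y)" X "\<lambda>x. A `` {x}"] tS
    unfolding inner by simp
  have "?\<phi> a * (\<Sum>y\<in>A `` {a}. f a - f y) \<le> infsum ?t A"
    unfolding outer
    using finite_sum_le_infsum[OF outer_summable, of "{a}"] a f(3) less_imp_le[OF f_pos] by simp
  moreover have "infsum ?t A = infsum (\<lambda>(x, y). ?\<phi> y * (f y - f x)) A"
    using infsum_reindex_bij_betw[OF swap, of ?t] by (simp add: case_prod_unfold)
  then have "2 * infsum ?t A = infsum (\<lambda>(x, y). ?\<phi> x * (f x - f y) + ?\<phi> y * (f y - f x)) A"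
    using infsum_add[OF t t'] by (simp add: case_prod_unfold)
  moreover have "infsum (\<lambda>(x, y). ?\<phi> x * (f x - f y) + ?\<phi> y * (f y - f x)) A \<le>
      infsum (\<lambda>(x, y). (w x - w y)\<^sup>2) A"
  proof (rule infsum_mono[OF _ sq])
    show "(\<lambda>(x, y). ?\<phi> x * (f x - f y) + ?\<phi> y * (f y - f x)) summable_on A"
      using summable_on_add[OF t t'] by (simp add: case_prod_unfold)
    have "p * (r - s) + q * (s - r) = (p - q) * (r - s)" for p q r s :: real
      by (simp add: algebra_simps)
    then have "?\<phi> x * (f x - f y) + ?\<phi> y * (f y - f x) \<le> (w x - w y)\<^sup>2" for x y
      using ground_state_pointwise[OF f_pos[of x] f_pos[of y], of "w x" "w y"] by metis
    then show "(case z of (x, y) \<Rightarrow> ?\<phi> x * (f x - f y) + ?\<phi> y * (f y - f x)) \<le> (case z of (x, y) \<Rightarrow> (w x - w y)\<^sup>2)" for z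
      by (cases z) simp
  qed
  moreover have "(\<Sum>y\<in>A `` {a}. f a - f y) * (w a)\<^sup>2 \<le> 2 * (?\<phi> a * (\<Sum>y\<in>A `` {a}. f a - f y))"
  proof -
    have "(w a)\<^sup>2 * f a \<le> (w a)\<^sup>2 * 2"
      by (rule mult_left_mono[OF f(2)]) simp
    then have "(w a)\<^sup>2 \<le> 2 * ?\<phi> a"
      using f_pos[of a] by (simp add: field_simps)
    from mult_right_mono[OF this f(3)[of a]] show ?thesis by (simp add: ac_simps)
  qed
  ultimately show "(\<Sum>y\<in>A `` {a}. f a - f y) * (w a)\<^sup>2 \<le> infsum (\<lambda>(x, y). (w x - w y)\<^sup>2) A"
    by linarith
qed

text \<open>The squared \<open>\<ell>\<^sup>2\<close> distance between \<open>w\<close> and its translate by \<open>g\<close>.\<close>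

definition displacement :: "'x set \<Rightarrow> ('x \<Rightarrow> 'g \<Rightarrow> 'x) \<Rightarrow> ('x \<Rightarrow> real) \<Rightarrow> 'g \<Rightarrow> real" where
  "displacement X act w g = infsum (\<lambda>x. (w x - w (act x g))\<^sup>2) X"

context right_action
begin

lemma act_inv: "x \<in> X \<Longrightarrow> g \<in> carrier G \<Longrightarrow> act (act x g) (inv g) = x"
  "x \<in> X \<Longrightarrow> g \<in> carrier G \<Longrightarrow> act (act x (inv g)) g = x"
  by (simp_all add: act_mult[symmetric] act_one)

lemma bij_betw_act: "g \<in> carrier G \<Longrightarrow> bij_betw (\<lambda>x. act x g) X X"
  by (rule bij_betwI[where g="\<lambda>x. act x (inv g)"]) (simp_all add: act_closed act_inv Pi_iff)

lemma summable_on_translate: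
  fixes w :: "'x \<Rightarrow> real"
  assumes "(\<lambda>x. (w x)\<^sup>2) summable_on X" "g \<in> carrier G"
  shows "(\<lambda>x. (w (act x g))\<^sup>2) summable_on X"
  using summable_on_reindex_bij_betw[OF bij_betw_act[OF assms(2)], of "\<lambda>x. (w x)\<^sup>2"] assms(1) by simp

lemma summable_on_displacement:
  fixes w :: "'x \<Rightarrow> real"
  assumes "(\<lambda>x. (w x)\<^sup>2) summable_on X" "g \<in> carrier G"
  shows "(\<lambda>x. (w x - w (act x g))\<^sup>2) summable_on X"
  by (rule summable_on_diff_squares[OF assms(1) summable_on_translate[OF assms]])

lemma displacement_inv:
  assumes "g \<in> carrier G"
  shows "displacement X act w (inv g) = displacement X act w g"
proof -
  have "displacement X act w (inv g) = infsum (\<lambda>x. (w (act x g) - w (act (act x g) (inv g)))\<^sup>2) X"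
    unfolding displacement_def
    by (rule infsum_reindex_bij_betw[OF bij_betw_act[OF assms], of "\<lambda>x. (w x - w (act x (inv g)))\<^sup>2", symmetric])
  also have "\<dots> = displacement X act w g"
    unfolding displacement_def using assms
    by (intro infsum_cong) (simp add: act_inv power2_commute)
  finally show ?thesis .
qed

text \<open>Translation by \<open>g\<close> is an isometry of \<open>\<ell>\<^sup>2\<close>, so the distance itself is subadditive; the factor \<open>2\<close>
  comes from squaring.\<close>

lemma displacement_mult_le:
  assumes w: "(\<lambda>x. (w x)\<^sup>2) summable_on X" and gh: "g \<in> carrier G" "h \<in> carrier G"
  shows "displacement X act w (g \<otimes> h) \<le> 2 * displacement X act w g + 2 * displacement X act w h"
proof -
  let ?d = "\<lambda>x. (w (act x g) - w (act (act x g) h))\<^sup>2"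
  have d: "?d summable_on X"
    using summable_on_reindex_bij_betw[OF bij_betw_act[OF gh(1)], of "\<lambda>x. (w x - w (act x h))\<^sup>2"]
      summable_on_displacement[OF w gh(2)] by simp
  have "infsum ?d X = displacement X act w h"
    unfolding displacement_def
    using infsum_reindex_bij_betw[OF bij_betw_act[OF gh(1)], of "\<lambda>x. (w x - w (act x h))\<^sup>2"] by simp
  moreover have "displacement X act w (g \<otimes> h) \<le> infsum (\<lambda>x. 2 * (w x - w (act x g))\<^sup>2 + 2 * ?d x) X"
    unfolding displacement_def
  proof (rule infsum_mono)
    show "(\<lambda>x. (w x - w (act x (g \<otimes> h)))\<^sup>2) summable_on X"
      using gh by (intro summable_on_displacement[OF w]) auto
    show "(\<lambda>x. 2 * (w x - w (act x g))\<^sup>2 + 2 * ?d x) summable_on X"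
      by (intro summable_on_add summable_on_cmult_right d summable_on_displacement[OF w gh(1)])
    fix x assume "x \<in> X"
    moreover have "(p - r)\<^sup>2 \<le> 2 * (p - q)\<^sup>2 + 2 * (q - r)\<^sup>2" for p q r :: real
      using zero_le_power2[of "p - q - (q - r)"] by (simp add: power2_eq_square algebra_simps)
    ultimately show "(w x - w (act x (g \<otimes> h)))\<^sup>2 \<le> 2 * (w x - w (act x g))\<^sup>2 + 2 * ?d x"
      using gh by (simp add: act_mult)
  qed
  ultimately show ?thesis
    using infsum_add[OF summable_on_cmult_right[OF summable_on_displacement[OF w gh(1)], of 2]
        summable_on_cmult_right[OF d, of 2]]
    by (simp add: infsum_cmult_right' displacement_def)
qed

lemma schreier_adj_Image:
  assumes "S \<subseteq> carrier G"
  shows "schreier_adj X act S `` {x} \<subseteq> (\<lambda>g. act x g) ` S \<union> (\<lambda>g. act x (inv g)) ` S"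
proof
  fix y assume "y \<in> schreier_adj X act S `` {x}"
  then consider s where "s \<in> S" "y = act x s" | s where "s \<in> S" "y \<in> X" "x = act y s"
    by (auto simp: schreier_adj_def Let_def)
  then show "y \<in> (\<lambda>g. act x g) ` S \<union> (\<lambda>g. act x (inv g)) ` S"
  proof cases
    case 2
    then have "y = act x (inv s)" using assms act_inv(1)[of y s] by auto
    then show ?thesis using 2 by blast
  qed auto
qed

lemma schreier_adj_subset: "S \<subseteq> carrier G \<Longrightarrow> schreier_adj X act S \<subseteq> X \<times> X"
  by (auto simp: schreier_adj_def Let_def act_closed subset_iff)

lemma sym_schreier_adj: "sym (schreier_adj X act S)"
  by (auto simp: schreier_adj_def Let_def sym_def)

text \<open>Each edge at \<open>x\<close> leads to some \<open>x.s\<close> or \<open>x.s\<inverse>\<close> with \<open>s \<in> S\<close>, so the Dirichlet energy of the graph is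
  at most the sum of the displacements of the generators and their inverses.\<close>

lemma transient_capacity_bound:
  assumes S: "finite S" "S \<subseteq> carrier G" and X: "countable X" "a \<in> X"
    and trans: "transient_graph X (schreier_adj X act S)"
  obtains c where "0 < c"
    "\<And>w. (\<lambda>x. (w x)\<^sup>2) summable_on X \<Longrightarrow> c * (w a)\<^sup>2 \<le> (\<Sum>s\<in>S. displacement X act w s)"
proof -
  let ?A = "schreier_adj X act S"
  let ?nb = "\<lambda>x. (\<lambda>g. act x g) ` S \<union> (\<lambda>g. act x (inv g)) ` S"
  note A = schreier_adj_subset[OF S(2)] sym_schreier_adj[of S]
  note nb = schreier_adj_Image[OF S(2)]
  have fin: "finite (?A `` {x})" for x
    by (rule finite_subset[OF nb]) (use S in auto)
  have card: "card (?A `` {x}) \<le> 2 * card S" for x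
  proof -
    have "card (?A `` {x}) \<le> card (?nb x)"
      by (rule card_mono[OF _ nb]) (use S in auto)
    also have "\<dots> \<le> card S + card S"
      by (rule order_trans[OF card_Un_le add_mono]) (auto intro: card_image_le S)
    finally show ?thesis by simp
  qed
  obtain f :: "_ \<Rightarrow> real" where f: "\<And>x. 1 \<le> f x" "\<And>x. f x \<le> 2" "\<And>x. 0 \<le> (\<Sum>y\<in>?A `` {x}. f x - f y)"
    and fa: "0 < (\<Sum>y\<in>?A `` {a}. f a - f y)"
    by (rule transient_graph_superharmonic[OF trans X A(1) fin]) (rule that)
  let ?c = "\<Sum>y\<in>?A `` {a}. f a - f y"
  show ?thesis
  proof (rule that)
    show "0 < ?c / 2" using fa by simp
    fix w :: "_ \<Rightarrow> real" assume w: "(\<lambda>x. (w x)\<^sup>2) summable_on X"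
    let ?h = "\<lambda>x y. (w x - w y)\<^sup>2"
    have Sigma: "?A = Sigma X (\<lambda>x. ?A `` {x})"
      using A by auto
    note cap = superharmonic_capacity_bound[OF A X(2) fin card f w]
    have hS: "(\<lambda>(x, y). ?h x y) summable_on Sigma X (\<lambda>x. ?A `` {x})"
      using cap(1) unfolding Sigma[symmetric] .
    have "((\<lambda>x. \<Sum>s\<in>S. ?h x (act x s) + ?h x (act x (inv s))) has_sum
        (\<Sum>s\<in>S. displacement X act w s + displacement X act w (inv s))) X"
      unfolding displacement_def using S
      by (intro has_sum_finite_sum has_sum_add has_sum_infsum summable_on_displacement[OF w]) auto
    also have "(\<Sum>s\<in>S. displacement X act w s + displacement X act w (inv s)) = 2 * (\<Sum>s\<in>S. displacement X act w s)"
      using S by (auto simp: sum_distrib_left displacement_inv intro!: sum.cong)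
    finally have sS: "((\<lambda>x. \<Sum>s\<in>S. ?h x (act x s) + ?h x (act x (inv s))) has_sum
        2 * (\<Sum>s\<in>S. displacement X act w s)) X" .
    have "infsum (\<lambda>(x, y). ?h x y) ?A = infsum (\<lambda>x. infsum (?h x) (?A `` {x})) X"
      using infsum_Sigma'_banach[OF hS] unfolding Sigma[symmetric] ..
    also have "\<dots> \<le> infsum (\<lambda>x. \<Sum>s\<in>S. ?h x (act x s) + ?h x (act x (inv s))) X"
    proof (rule infsum_mono[OF summable_on_Sigma_banach[OF hS] has_sum_imp_summable[OF sS]])
      fix x
      have "infsum (?h x) (?A `` {x}) = (\<Sum>y\<in>?A `` {x}. ?h x y)"
        using fin[of x] by simp
      also have "\<dots> \<le> (\<Sum>y\<in>?nb x. ?h x y)"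
        by (rule sum_mono2) (use S nb in auto)
      also have "\<dots> \<le> (\<Sum>y\<in>(\<lambda>g. act x g) ` S. ?h x y) + (\<Sum>y\<in>(\<lambda>g. act x (inv g)) ` S. ?h x y)"
        using S by (subst sum_Un) (auto intro: sum_nonneg)
      also have "\<dots> \<le> (\<Sum>s\<in>S. ?h x (act x s)) + (\<Sum>s\<in>S. ?h x (act x (inv s)))"
        using S sum_image_le[of S "?h x" "\<lambda>g. act x g"] sum_image_le[of S "?h x" "\<lambda>g. act x (inv g)"]
        by (intro add_mono) (auto simp: o_def)
      finally show "infsum (?h x) (?A `` {x}) \<le> (\<Sum>s\<in>S. ?h x (act x s) + ?h x (act x (inv s)))"
        by (simp add: sum.distrib)
    qed
    also have "\<dots> = 2 * (\<Sum>s\<in>S. displacement X act w s)"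
      using sS by (rule infsumI)
    finally show "?c / 2 * (w a)\<^sup>2 \<le> (\<Sum>s\<in>S. displacement X act w s)"
      using cap(2) by simp
  qed
qed

end


section \<open>The Green function of the induced walk\<close>

text \<open>With probability \<open>q\<close> the geometric time is \<open>0\<close>; otherwise it is one more than another geometric time.
  This is the resolvent equation for the law \<open>\<rho>\<close> of the stopped chain.\<close>

lemma pmf_geometric_chain:
  fixes \<kappa> :: "'x \<Rightarrow> 'x pmf" and a :: 'x
  assumes q: "0 < q" "q < 1"
  defines "\<rho> \<equiv> bind_pmf (geometric_pmf q) (chain_law (\<lambda>_. \<kappa>) a)"
  shows "pmf \<rho> x = q * indicator {a} x + (1 - q) * pmf (bind_pmf \<rho> \<kappa>) x"
proof -
  have step: "bind_pmf (map_pmf Suc (geometric_pmf q)) (chain_law (\<lambda>_. \<kappa>) a) = bind_pmf \<rho> \<kappa>"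
    unfolding \<rho>_def by (simp add: bind_map_pmf bind_assoc_pmf)
  have "\<rho> = bind_pmf (bernoulli_pmf q)
      (\<lambda>b. if b then return_pmf a else bind_pmf \<rho> \<kappa>)"
    unfolding step[symmetric] unfolding \<rho>_def
    by (subst geometric_bind_pmf_unfold)
       (use q in \<open>auto simp: bind_assoc_pmf bind_return_pmf if_distrib[where f="\<lambda>p. bind_pmf p _"] cong: if_cong\<close>)
  then have "pmf \<rho> x = pmf (bind_pmf (bernoulli_pmf q) (\<lambda>b. if b then return_pmf a else bind_pmf \<rho> \<kappa>)) x"
    by simp
  also have "\<dots> = q * indicator {a} x + (1 - q) * pmf (bind_pmf \<rho> \<kappa>) x"
    using q by (simp add: pmf_bind indicator_def)
  finally show ?thesis .
qed

lemma sum_le_pmf_geometric_chain: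
  assumes q: "0 < q" "q < 1"
  shows "q * (\<Sum>n<N. (1 - q) ^ n * pmf (chain_law \<kappa> a n) x)
    \<le> pmf (bind_pmf (geometric_pmf q) (chain_law \<kappa> a)) x"
proof -
  let ?p = "\<lambda>n. pmf (chain_law \<kappa> a n) x"
  have fin: "measure_pmf.expectation (geometric_pmf q) (\<lambda>n. ?p n * indicator {..<N} n) =
      (\<Sum>n<N. pmf (geometric_pmf q) n *\<^sub>R (?p n * indicator {..<N} n))"
    by (rule integral_measure_pmf) (auto split: split_indicator_asm)
  have "q * (\<Sum>n<N. (1 - q) ^ n * ?p n) = measure_pmf.expectation (geometric_pmf q) (\<lambda>n. ?p n * indicator {..<N} n)"
    unfolding fin sum_distrib_left using q by (intro sum.cong) auto
  also have "\<dots> \<le> measure_pmf.expectation (geometric_pmf q) ?p"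
    by (intro integral_mono integrable_pmf_bounded[where B=1])
       (auto simp: pmf_le_1 split: split_indicator)
  also have "\<dots> = pmf (bind_pmf (geometric_pmf q) (chain_law \<kappa> a)) x"
    by (simp add: pmf_bind)
  finally show ?thesis .
qed

lemma summable_on_pmf_power2:
  "(\<lambda>x. (pmf p x)\<^sup>2) summable_on X"
proof (rule summable_on_comparison_test)
  show "pmf p summable_on X"
    by (rule nonneg_bounded_partial_sums_imp_summable_on[where C=1])
       (auto intro!: eventually_finite_subsets_at_top_weakI simp: measure_measure_pmf_finite[symmetric])
  show "(pmf p x)\<^sup>2 \<le> pmf p x" for x
    using mult_left_mono[OF pmf_le_1[of p x], of "pmf p x"] by (simp add: power2_eq_square)
qed simp

context right_action
begin

abbreviation walk_kernel :: "'g pmf \<Rightarrow> 'x \<Rightarrow> 'x pmf" where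
  "walk_kernel \<mu> x \<equiv> map_pmf (act x) \<mu>"

lemma set_walk_kernel:
  "set_pmf \<mu> \<subseteq> carrier G \<Longrightarrow> x \<in> X \<Longrightarrow> set_pmf (walk_kernel \<mu> x) \<subseteq> X"
  by (auto simp: act_closed subset_iff)

lemma set_walk_law:
  assumes "set_pmf \<mu> \<subseteq> carrier G" "a \<in> X"
  shows "set_pmf (chain_law (\<lambda>_. walk_kernel \<mu>) a n) \<subseteq> X"
proof (induction n)
  case (Suc n)
  then show ?case using set_walk_kernel[OF assms(1)] by auto
qed (use assms in simp)

text \<open>The group acts by bijections, so the mass that a step carries to \<open>x\<close> comes, for each increment \<open>g\<close>,
  from the single point \<open>x.g\<inverse>\<close>.\<close>

lemma pmf_walk_step:
  assumes \<mu>: "set_pmf \<mu> \<subseteq> carrier G" and p: "set_pmf p \<subseteq> X" and x: "x \<in> X"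
  shows "pmf (bind_pmf p (walk_kernel \<mu>)) x = measure_pmf.expectation \<mu> (\<lambda>g. pmf p (act x (inv g)))"
proof -
  have "bind_pmf p (walk_kernel \<mu>) = bind_pmf \<mu> (\<lambda>g. map_pmf (\<lambda>z. act z g) p)"
    unfolding map_pmf_def by (rule bind_commute_pmf)
  then have "pmf (bind_pmf p (walk_kernel \<mu>)) x = measure_pmf.expectation \<mu> (\<lambda>g. pmf (map_pmf (\<lambda>z. act z g) p) x)"
    by (simp add: pmf_bind)
  also have "\<dots> = measure_pmf.expectation \<mu> (\<lambda>g. pmf p (act x (inv g)))"
  proof (rule integral_cong_AE)
    show "AE g in measure_pmf \<mu>. pmf (map_pmf (\<lambda>z. act z g) p) x = pmf p (act x (inv g))"
    proof (rule AE_pmfI)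
      fix g assume "g \<in> set_pmf \<mu>"
      then have g: "g \<in> carrier G" using \<mu> by auto
      have "measure_pmf.prob p ((\<lambda>z. act z g) -` {x}) = measure_pmf.prob p {act x (inv g)}"
        by (rule measure_eq_AE) (use p g x in \<open>auto simp: AE_measure_pmf_iff act_inv subset_iff\<close>)
      then show "pmf (map_pmf (\<lambda>z. act z g) p) x = pmf p (act x (inv g))"
        by (simp add: pmf_map measure_pmf_single)
    qed
  qed simp_all
  finally show ?thesis .
qed

text \<open>Averaging \<open>w\<^sup>2\<close> over the translations drawn from \<open>\<mu>\<close> does not increase its sum. This is the invariance
  of counting measure, the property that replaces reversibility of the walk.\<close>

lemma expectation_translate_summable:
  fixes w :: "'x \<Rightarrow> real"
  assumes \<mu>: "set_pmf \<mu> \<subseteq> carrier G" and w: "(\<lambda>x. (w x)\<^sup>2) summable_on X"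
    and int: "\<And>x. integrable (measure_pmf \<mu>) (\<lambda>g. (w (act x (inv g)))\<^sup>2)"
  shows "(\<lambda>x. measure_pmf.expectation \<mu> (\<lambda>g. (w (act x (inv g)))\<^sup>2)) summable_on X"
    and "infsum (\<lambda>x. measure_pmf.expectation \<mu> (\<lambda>g. (w (act x (inv g)))\<^sup>2)) X \<le> infsum (\<lambda>x. (w x)\<^sup>2) X"
proof -
  let ?q = "\<lambda>x. measure_pmf.expectation \<mu> (\<lambda>g. (w (act x (inv g)))\<^sup>2)"
  have part: "sum ?q F \<le> infsum (\<lambda>x. (w x)\<^sup>2) X" if F: "finite F" "F \<subseteq> X" for F
  proof -
    have "sum ?q F = measure_pmf.expectation \<mu> (\<lambda>g. \<Sum>x\<in>F. (w (act x (inv g)))\<^sup>2)"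
      by (simp add: Bochner_Integration.integral_sum int)
    also have "\<dots> \<le> infsum (\<lambda>x. (w x)\<^sup>2) X"
    proof (rule measure_pmf.integral_le_const)
      show "integrable (measure_pmf \<mu>) (\<lambda>g. \<Sum>x\<in>F. (w (act x (inv g)))\<^sup>2)"
        by (intro Bochner_Integration.integrable_sum int)
      show "AE g in measure_pmf \<mu>. (\<Sum>x\<in>F. (w (act x (inv g)))\<^sup>2) \<le> infsum (\<lambda>x. (w x)\<^sup>2) X"
      proof (rule AE_pmfI)
        fix g assume "g \<in> set_pmf \<mu>"
        then have g: "inv g \<in> carrier G" using \<mu> by auto
        have "(\<Sum>x\<in>F. (w (act x (inv g)))\<^sup>2) \<le> infsum (\<lambda>x. (w (act x (inv g)))\<^sup>2) X"
          by (rule finite_sum_le_infsum[OF summable_on_translate[OF w g]]) (use F in auto)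
        then show "(\<Sum>x\<in>F. (w (act x (inv g)))\<^sup>2) \<le> infsum (\<lambda>x. (w x)\<^sup>2) X"
          using infsum_reindex_bij_betw[OF bij_betw_act[OF g], of "\<lambda>x. (w x)\<^sup>2"] by simp
      qed
    qed
    finally show ?thesis .
  qed
  show summ: "?q summable_on X"
    by (rule nonneg_bdd_above_summable_on) (auto intro!: bdd_aboveI2[where M="infsum (\<lambda>x. (w x)\<^sup>2) X"] part)
  show "infsum ?q X \<le> infsum (\<lambda>x. (w x)\<^sup>2) X"
    by (rule infsum_le_finite_sums[OF summ part])
qed

text \<open>The property of the law of the geometrically stopped walk that the estimates use; the discounted
  Green function is \<open>\<rho> / q\<close>.\<close>

definition resolvent_law :: "'g pmf \<Rightarrow> 'x \<Rightarrow> real \<Rightarrow> 'x pmf \<Rightarrow> bool" where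
  "resolvent_law \<mu> a q \<rho> \<longleftrightarrow> 0 < q \<and> q < 1 \<and> set_pmf \<rho> \<subseteq> X \<and>
    (\<forall>x\<in>X. pmf \<rho> x = q * indicator {a} x + (1 - q) * pmf (bind_pmf \<rho> (walk_kernel \<mu>)) x)"

lemma resolvent_lawD:
  assumes "resolvent_law \<mu> a q \<rho>"
  shows "0 < q" "q < 1" "set_pmf \<rho> \<subseteq> X"
    "\<And>x. x \<in> X \<Longrightarrow> pmf \<rho> x = q * indicator {a} x + (1 - q) * pmf (bind_pmf \<rho> (walk_kernel \<mu>)) x"
  using assms by (auto simp: resolvent_law_def)

text \<open>Pair the resolvent equation with \<open>\<rho>\<close>. By polarisation, \<open>2 \<rho>(x) \<rho>(x.g\<inverse>)\<close> equals
  \<open>\<rho>(x)\<^sup>2 + \<rho>(x.g\<inverse>)\<^sup>2\<close> minus the square of the difference; that square is kept for \<open>g = b\<close> and dropped for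
  all other \<open>g\<close>. After summation over \<open>x\<close> the terms \<open>\<rho>\<^sup>2\<close> on the right are at most
  \<open>2 (1 - q) \<parallel>\<rho>\<parallel>\<^sup>2\<close> and are absorbed by \<open>2 \<parallel>\<rho>\<parallel>\<^sup>2\<close> on the left.\<close>

lemma resolvent_displacement_bound:
  assumes \<mu>: "set_pmf \<mu> \<subseteq> carrier G" and a: "a \<in> X" and res: "resolvent_law \<mu> a q \<rho>"
    and b: "b \<in> set_pmf \<mu>"
  shows "(1 - q) * pmf \<mu> b * displacement X act (pmf \<rho>) b \<le> 2 * q * pmf \<rho> a"
proof -
  note q = resolvent_lawD(1,2)[OF res] and \<rho> = resolvent_lawD(3,4)[OF res]
  let ?r = "pmf \<rho>"
  let ?E = "measure_pmf.expectation \<mu>"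
  let ?q = "\<lambda>x. ?E (\<lambda>g. (?r (act x (inv g)))\<^sup>2)"
  let ?e = "\<lambda>x. (?r x - ?r (act x (inv b)))\<^sup>2"
  let ?N = "infsum (\<lambda>x. (?r x)\<^sup>2) X"
  have bG: "b \<in> carrier G" "inv b \<in> carrier G" using b \<mu> by auto
  note r2 = summable_on_pmf_power2[of \<rho> X]
  have int: "integrable (measure_pmf \<mu>) (\<lambda>g. (?r (act x (inv g)))\<^sup>2)"
    and int1: "integrable (measure_pmf \<mu>) (\<lambda>g. ?r (act x (inv g)))" for x
    by (auto intro!: integrable_pmf_bounded[where B=1] power_le_one simp: pmf_le_1)
  note q_sum = expectation_translate_summable[OF \<mu> r2 int]
  have e_sum: "?e summable_on X"
    by (rule summable_on_displacement[OF r2 bG(2)])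
  have e_inf: "infsum ?e X = displacement X act ?r b"
    using displacement_inv[OF bG(1)] by (simp add: displacement_def)
  let ?\<delta> = "\<lambda>x. 2 * q * ?r a * indicator {a} x"
  have \<delta>1: "infsum (indicat_real {a}) X = 1"
    by (rule infsumI, rule has_sum_finite_neutralI[of "{a}"]) (use a in auto)
  have \<delta>: "(?\<delta> has_sum 2 * q * ?r a) X"
    by (rule has_sum_finite_neutralI[of "{a}"]) (use a in auto)
  have pointwise: "2 * (?r x)\<^sup>2 + (1 - q) * pmf \<mu> b * ?e x \<le> 2 * q * ?r a * indicator {a} x + (1 - q) * ((?r x)\<^sup>2 + ?q x)"
    if "x \<in> X" for x
  proof -
    have int_b: "integrable (measure_pmf \<mu>) (\<lambda>g. indicator {b} g * ?e x)"
      by (rule integrable_pmf_bounded[where B="?e x"]) (auto split: split_indicator)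
    have "2 * (?r x * ?E (\<lambda>g. ?r (act x (inv g)))) = ?E (\<lambda>g. 2 * (?r x * ?r (act x (inv g))))"
      by simp
    also have "\<dots> \<le> ?E (\<lambda>g. (?r x)\<^sup>2 + (?r (act x (inv g)))\<^sup>2 - indicator {b} g * ?e x)"
    proof (rule integral_mono)
      show "integrable (measure_pmf \<mu>) (\<lambda>g. 2 * (?r x * ?r (act x (inv g))))"
        by (intro integrable_mult_right int1)
      show "integrable (measure_pmf \<mu>) (\<lambda>g. (?r x)\<^sup>2 + (?r (act x (inv g)))\<^sup>2 - indicator {b} g * ?e x)"
        by (intro Bochner_Integration.integrable_diff Bochner_Integration.integrable_add int int_b) simp
      fix g
      have "2 * (u * v) = u\<^sup>2 + v\<^sup>2 - (u - v)\<^sup>2" "2 * (u * v) \<le> u\<^sup>2 + v\<^sup>2" for u v :: real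
        using zero_le_power2[of "u - v"] by (auto simp: power2_eq_square algebra_simps)
      then show "2 * (?r x * ?r (act x (inv g))) \<le> (?r x)\<^sup>2 + (?r (act x (inv g)))\<^sup>2 - indicator {b} g * ?e x"
        by (cases "g = b") auto
    qed
    also have "\<dots> = (?r x)\<^sup>2 + ?q x - pmf \<mu> b * ?e x"
      using int[of x] int_b by (simp add: Bochner_Integration.integral_diff Bochner_Integration.integral_add measure_pmf_single)
    finally have mix: "2 * (?r x * ?E (\<lambda>g. ?r (act x (inv g)))) \<le> (?r x)\<^sup>2 + ?q x - pmf \<mu> b * ?e x" .
    have "2 * (?r x)\<^sup>2 = 2 * ?r x * (q * indicator {a} x + (1 - q) * ?E (\<lambda>g. ?r (act x (inv g))))"
      using \<rho>(2)[OF that] pmf_walk_step[OF \<mu> \<rho>(1) that] by (simp add: power2_eq_square)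
    also have "\<dots> = 2 * q * ?r a * indicator {a} x + (1 - q) * (2 * (?r x * ?E (\<lambda>g. ?r (act x (inv g)))))"
      by (auto simp: algebra_simps split: split_indicator)
    also have "\<dots> \<le> 2 * q * ?r a * indicator {a} x + (1 - q) * ((?r x)\<^sup>2 + ?q x - pmf \<mu> b * ?e x)"
      using q by (intro add_left_mono mult_left_mono mix) auto
    finally show ?thesis by (simp add: algebra_simps)
  qed
  have "2 * ?N + (1 - q) * pmf \<mu> b * infsum ?e X =
      infsum (\<lambda>x. 2 * (?r x)\<^sup>2 + (1 - q) * pmf \<mu> b * ?e x) X"
    by (subst infsum_add) (auto intro!: summable_on_cmult_right r2 e_sum simp: infsum_cmult_right')
  also have "\<dots> \<le> infsum (\<lambda>x. 2 * q * ?r a * indicator {a} x + (1 - q) * ((?r x)\<^sup>2 + ?q x)) X"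
  proof (rule infsum_mono)
    show "(\<lambda>x. 2 * (?r x)\<^sup>2 + (1 - q) * pmf \<mu> b * ?e x) summable_on X"
      by (intro summable_on_add summable_on_cmult_right r2 e_sum)
    show "(\<lambda>x. 2 * q * ?r a * indicator {a} x + (1 - q) * ((?r x)\<^sup>2 + ?q x)) summable_on X"
      by (intro summable_on_add summable_on_cmult_right r2 q_sum(1) has_sum_imp_summable[OF \<delta>])
  qed (rule pointwise)
  also have "\<dots> = 2 * q * ?r a + (1 - q) * (?N + infsum ?q X)"
    by (subst infsum_add)
       (auto intro!: summable_on_cmult_right summable_on_add r2 q_sum(1) has_sum_imp_summable[OF \<delta>]
         simp: infsum_cmult_right' infsum_add[OF r2 q_sum(1)] \<delta>1)
  also have "\<dots> \<le> 2 * q * ?r a + (1 - q) * (?N + ?N)"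
    using q q_sum(2) by (intro add_left_mono mult_left_mono) auto
  finally have "(1 - q) * pmf \<mu> b * infsum ?e X + 2 * q * ?N \<le> 2 * q * ?r a"
    by (simp add: algebra_simps)
  moreover have "0 \<le> 2 * q * ?N"
    using q by (intro mult_nonneg_nonneg infsum_nonneg) auto
  ultimately show ?thesis
    unfolding e_inf by linarith
qed

text \<open>Away from \<open>a\<close>, a value of \<open>\<rho>\<close> is \<open>1 - q\<close> times an average of values, so it is at most \<open>(1 - q) s\<close>,
  where \<open>s\<close> is the supremum of \<open>\<rho>\<close>. As \<open>1 - q < 1\<close>, the supremum cannot exceed \<open>\<rho>(a)\<close>.\<close>

lemma resolvent_maximum_principle:
  assumes \<mu>: "set_pmf \<mu> \<subseteq> carrier G" and a: "a \<in> X" and res: "resolvent_law \<mu> a q \<rho>"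
  shows "pmf \<rho> x \<le> pmf \<rho> a"
proof -
  note q = resolvent_lawD(1,2)[OF res] and \<rho> = resolvent_lawD(3,4)[OF res]
  let ?s = "SUP x. pmf \<rho> x"
  have bdd: "bdd_above (range (pmf \<rho>))"
    by (rule bdd_aboveI2[where M=1]) (simp add: pmf_le_1)
  have le_s: "pmf \<rho> x \<le> ?s" for x
    by (rule cSUP_upper[OF UNIV_I bdd])
  have le: "pmf \<rho> x \<le> max (pmf \<rho> a) ((1 - q) * ?s)" for x
  proof (cases "x = a \<or> x \<notin> X")
    case True
    then show ?thesis
      using \<rho>(1) set_pmf_iff[of x \<rho>] by (auto intro: max.coboundedI1)
  next
    case False
    have "pmf (bind_pmf \<rho> (walk_kernel \<mu>)) x \<le> ?s"
      using pmf_walk_step[OF \<mu> \<rho>(1), of x] False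
      by (auto intro!: measure_pmf.integral_le_const integrable_pmf_bounded[where B=1] le_s simp: pmf_le_1)
    then have "(1 - q) * pmf (bind_pmf \<rho> (walk_kernel \<mu>)) x \<le> (1 - q) * ?s"
      using q by (intro mult_left_mono) auto
    then show ?thesis
      using \<rho>(2)[of x] False by (simp add: max.coboundedI2)
  qed
  have "?s \<le> max (pmf \<rho> a) ((1 - q) * ?s)"
    by (rule cSUP_least) (auto intro: le)
  moreover have "0 \<le> ?s"
    using le_s[of a] pmf_nonneg[of \<rho> a] by linarith
  moreover have "(1 - q) * ?s = ?s - q * ?s" by (simp add: algebra_simps)
  moreover have "0 < q * ?s" if "0 < ?s" using q that by simp
  ultimately have "?s \<le> pmf \<rho> a"
    by (cases "?s = 0") (auto simp: max_def split: if_splits)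
  then show ?thesis using le_s[of x] by linarith
qed

text \<open>The bound passes from the support of \<open>\<mu>\<close> to every product of its elements. What matters is that the
  constant depends on \<open>g\<close> but not on \<open>q\<close>.\<close>

lemma resolvent_displacement_bound_all:
  assumes \<mu>: "set_pmf \<mu> \<subseteq> carrier G" and a: "a \<in> X" and g: "g \<in> semigroup_generate G (set_pmf \<mu>)"
  shows "\<exists>C\<ge>0. \<forall>q \<rho>. resolvent_law \<mu> a q \<rho> \<longrightarrow>
    (1 - q) * displacement X act (pmf \<rho>) g \<le> C * (q * pmf \<rho> a)"
  using g
proof induction
  case (incl b)
  then have pos: "0 < pmf \<mu> b" by (simp add: pmf_positive)
  show ?case
  proof (intro exI[of _ "2 / pmf \<mu> b"] conjI allI impI)
    fix q \<rho> assume "resolvent_law \<mu> a q \<rho>"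
    from resolvent_displacement_bound[OF \<mu> a this incl]
    show "(1 - q) * displacement X act (pmf \<rho>) b \<le> 2 / pmf \<mu> b * (q * pmf \<rho> a)"
      using pos by (simp add: field_simps)
  qed (use pos in simp)
next
  case (mult g h)
  have sub: "semigroup_generate G (set_pmf \<mu>) \<subseteq> carrier G"
  proof
    fix x assume "x \<in> semigroup_generate G (set_pmf \<mu>)"
    then show "x \<in> carrier G" using \<mu> by induction auto
  qed
  obtain C where C: "C \<ge> 0" "\<And>q \<rho>. resolvent_law \<mu> a q \<rho> \<Longrightarrow>
    (1 - q) * displacement X act (pmf \<rho>) g \<le> C * (q * pmf \<rho> a)"
    using mult.IH(1) by blast
  obtain D where D: "D \<ge> 0" "\<And>q \<rho>. resolvent_law \<mu> a q \<rho> \<Longrightarrow>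
    (1 - q) * displacement X act (pmf \<rho>) h \<le> D * (q * pmf \<rho> a)"
    using mult.IH(2) by blast
  show ?case
  proof (intro exI[of _ "2 * C + 2 * D"] conjI allI impI)
    fix q \<rho> assume res: "resolvent_law \<mu> a q \<rho>"
    have "(1 - q) * displacement X act (pmf \<rho>) (g \<otimes> h) \<le>
        (1 - q) * (2 * displacement X act (pmf \<rho>) g + 2 * displacement X act (pmf \<rho>) h)"
      using resolvent_lawD(2)[OF res] sub mult.hyps
      by (intro mult_left_mono displacement_mult_le summable_on_pmf_power2) auto
    also have "\<dots> \<le> (2 * C + 2 * D) * (q * pmf \<rho> a)"
      using C(2)[OF res] D(2)[OF res] by (simp add: algebra_simps)
    finally show "(1 - q) * displacement X act (pmf \<rho>) (g \<otimes> h) \<le> (2 * C + 2 * D) * (q * pmf \<rho> a)" .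
  qed (use C D in simp)
qed

text \<open>The capacity bound for \<open>w = \<rho>\<close> is quadratic in \<open>\<rho>(a)\<close>, while the displacements of \<open>\<rho>\<close> are bounded
  linearly in \<open>\<rho>(a)\<close>; dividing by \<open>\<rho>(a)\<close> leaves \<open>\<rho>(a) \<le> C q / (1 - q)\<close>. Here \<open>t = 1 - q\<close> is the discount
  factor, which tends to \<open>1\<close> in the end. The sums are truncated at \<open>N\<close>, so that the limit is taken in
  a polynomial.\<close>

lemma green_function_bounded:
  assumes \<mu>: "set_pmf \<mu> \<subseteq> carrier G" "semigroup_generate G (set_pmf \<mu>) = carrier G"
    and S: "finite S" "S \<subseteq> carrier G" and X: "countable X" "a \<in> X"
    and trans: "transient_graph X (schreier_adj X act S)"
  obtains C where "\<And>N x. (\<Sum>n<N. pmf (chain_law (\<lambda>_. walk_kernel \<mu>) a n) x) \<le> C"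
proof -
  obtain c where c: "0 < c"
    "\<And>w. (\<lambda>x. (w x)\<^sup>2) summable_on X \<Longrightarrow> c * (w a)\<^sup>2 \<le> (\<Sum>s\<in>S. displacement X act w s)"
    by (rule transient_capacity_bound[OF S X trans]) (rule that)
  have "\<forall>s\<in>S. \<exists>C\<ge>0. \<forall>q \<rho>. resolvent_law \<mu> a q \<rho> \<longrightarrow>
      (1 - q) * displacement X act (pmf \<rho>) s \<le> C * (q * pmf \<rho> a)"
  proof
    fix s assume "s \<in> S"
    then have "s \<in> semigroup_generate G (set_pmf \<mu>)" using S(2) \<mu>(2) by auto
    from resolvent_displacement_bound_all[OF \<mu>(1) X(2) this]
    show "\<exists>C\<ge>0. \<forall>q \<rho>. resolvent_law \<mu> a q \<rho> \<longrightarrow>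
      (1 - q) * displacement X act (pmf \<rho>) s \<le> C * (q * pmf \<rho> a)" .
  qed
  then obtain C where C: "\<And>s. s \<in> S \<Longrightarrow> C s \<ge> 0"
    "\<And>s q \<rho>. s \<in> S \<Longrightarrow> resolvent_law \<mu> a q \<rho> \<Longrightarrow> (1 - q) * displacement X act (pmf \<rho>) s \<le> C s * (q * pmf \<rho> a)"
    unfolding bchoice_iff by blast
  let ?C = "sum C S / c"
  show ?thesis
  proof (rule that)
    fix N x
    let ?p = "\<lambda>n. pmf (chain_law (\<lambda>_. walk_kernel \<mu>) a n) x"
    have bound: "t * (\<Sum>n<N. t ^ n * ?p n) \<le> ?C" if t: "0 < t" "t < 1" for t :: real
    proof -
      let ?\<rho> = "bind_pmf (geometric_pmf (1 - t)) (chain_law (\<lambda>_. walk_kernel \<mu>) a)"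
      have q: "0 < 1 - t" "1 - t < 1" using t by auto
      have \<rho>X: "set_pmf ?\<rho> \<subseteq> X"
        using set_walk_law[OF \<mu>(1) X(2)] by auto
      note \<rho>_rec = pmf_geometric_chain[OF q, of "walk_kernel \<mu>" a]
      have res: "resolvent_law \<mu> a (1 - t) ?\<rho>"
        unfolding resolvent_law_def using q \<rho>X \<rho>_rec by blast
      have "(1 - t) * (\<Sum>n<N. t ^ n * ?p n) \<le> pmf ?\<rho> x"
        using sum_le_pmf_geometric_chain[OF q, where N=N and \<kappa>="\<lambda>_. walk_kernel \<mu>" and a=a and x=x]
        by simp
      also have "\<dots> \<le> pmf ?\<rho> a"
        by (rule resolvent_maximum_principle[OF \<mu>(1) X(2) res])
      finally have le: "(1 - t) * (\<Sum>n<N. t ^ n * ?p n) \<le> pmf ?\<rho> a" .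
      have "t * (c * (pmf ?\<rho> a)\<^sup>2) \<le> t * (\<Sum>s\<in>S. displacement X act (pmf ?\<rho>) s)"
        using t by (intro mult_left_mono c(2) summable_on_pmf_power2) auto
      also have "\<dots> \<le> (\<Sum>s\<in>S. C s * ((1 - t) * pmf ?\<rho> a))"
        unfolding sum_distrib_left using C(2)[OF _ res] by (intro sum_mono) simp
      also have "\<dots> = sum C S * (1 - t) * pmf ?\<rho> a"
        by (simp add: sum_distrib_right sum_distrib_left ac_simps)
      finally have sq: "(t * c * pmf ?\<rho> a) * pmf ?\<rho> a \<le> (sum C S * (1 - t)) * pmf ?\<rho> a"
        by (simp add: power2_eq_square ac_simps)
      have Ca: "t * c * pmf ?\<rho> a \<le> sum C S * (1 - t)"
      proof (cases "pmf ?\<rho> a = 0")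
        case True
        then show ?thesis using C(1) t by (simp add: sum_nonneg)
      next
        case False
        then show ?thesis using sq pmf_nonneg[of ?\<rho> a] by (simp add: mult_le_cancel_right)
      qed
      have tc: "0 \<le> t * c" using t c(1) by simp
      have "t * c * ((1 - t) * (\<Sum>n<N. t ^ n * ?p n)) \<le> sum C S * (1 - t)"
        by (rule order_trans[OF mult_left_mono[OF le tc] Ca])
      then have "(t * c * (\<Sum>n<N. t ^ n * ?p n)) * (1 - t) \<le> sum C S * (1 - t)"
        by (simp add: ac_simps)
      then have "t * c * (\<Sum>n<N. t ^ n * ?p n) \<le> sum C S"
        using t by (simp add: mult_le_cancel_right)
      then show ?thesis using c by (simp add: field_simps)
    qed
    have "((\<lambda>t. t * (\<Sum>n<N. t ^ n * ?p n)) \<longlongrightarrow> 1 * (\<Sum>n<N. 1 ^ n * ?p n)) (at_left 1)"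
      by (intro tendsto_intros)
    moreover have "\<forall>\<^sub>F t in at_left (1::real). t * (\<Sum>n<N. t ^ n * ?p n) \<le> ?C"
      using eventually_at_left_real[of 0 "1::real"] by (auto elim!: eventually_mono intro!: bound)
    ultimately show "(\<Sum>n<N. ?p n) \<le> ?C"
      using tendsto_upperbound[of "\<lambda>t. t * (\<Sum>n<N. t ^ n * ?p n)" _ "at_left 1" ?C] by simp
  qed
qed

end


section \<open>Trails and ends\<close>

lemma component_of_eq:
  assumes "sym A" "(x, y) \<in> (A \<inter> (X - K) \<times> (X - K))\<^sup>*"
  shows "component_of X A K x = component_of X A K y"
proof -
  let ?R = "A \<inter> (X - K) \<times> (X - K)"
  have "sym ?R" using assms(1) by (auto simp: sym_def)
  then have "(y, x) \<in> ?R\<^sup>*" using assms(2) by (metis sym_rtrancl symD)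
  then show ?thesis
    using assms(2) unfolding component_of_def by (auto intro: rtrancl_trans)
qed

text \<open>The end assigns to \<open>K\<close> the component of \<open>X - K\<close> in which the path eventually stays. For \<open>K \<subseteq> L\<close> both
  components contain the path at all late times, hence are nested.\<close>

lemma converges_to_end_if_stays_connected:
  assumes "sym A"
    and conn: "\<And>K. finite K \<Longrightarrow> K \<subseteq> X \<Longrightarrow> \<forall>\<^sub>F n in sequentially.
      x n \<in> X - K \<and> (x n, x (Suc n)) \<in> (A \<inter> (X - K) \<times> (X - K))\<^sup>*"
  shows "\<exists>U\<in>graph_ends X A. converges_to_end X x U"
proof -
  let ?R = "\<lambda>K. A \<inter> (X - K) \<times> (X - K)"
  have "\<forall>K\<in>{K. finite K \<and> K \<subseteq> X}. \<exists>N. \<forall>n\<ge>N. x n \<in> X - K \<and> (x n, x (Suc n)) \<in> (?R K)\<^sup>*"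
    using conn by (auto simp: eventually_sequentially)
  then obtain N where N: "\<And>K n. finite K \<Longrightarrow> K \<subseteq> X \<Longrightarrow> N K \<le> n \<Longrightarrow> x n \<in> X - K"
    "\<And>K n. finite K \<Longrightarrow> K \<subseteq> X \<Longrightarrow> N K \<le> n \<Longrightarrow> (x n, x (Suc n)) \<in> (?R K)\<^sup>*"
    unfolding bchoice_iff by blast
  have path: "(x (N K), x n) \<in> (?R K)\<^sup>*" if "finite K" "K \<subseteq> X" "N K \<le> n" for K n
    using that(3)
  proof (induction n rule: dec_induct)
    case (step n)
    then show ?case using N(2)[OF that(1,2) step.hyps(1)] by (auto intro: rtrancl_trans)
  qed simp
  define U where "U = (\<lambda>K\<in>{K. finite K \<and> K \<subseteq> X}. component_of X A K (x (N K)))"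
  have U: "U K = component_of X A K (x n)" if "finite K" "K \<subseteq> X" "N K \<le> n" for K n
    using that component_of_eq[OF assms(1) path[OF that]] by (simp add: U_def)
  have "U \<in> graph_ends X A"
    unfolding graph_ends_def
  proof (intro CollectI conjI allI impI PiE_I)
    fix K assume "K \<in> {K. finite K \<and> K \<subseteq> X}"
    then show "U K \<in> components_off X A K"
      using U[of K "N K"] N(1)[of K "N K"] by (simp add: components_off_def)
  next
    fix K L assume KL: "finite L \<and> L \<subseteq> X \<and> K \<subseteq> L"
    then have K: "finite K" "K \<subseteq> X" by (auto intro: finite_subset)
    let ?n = "max (N K) (N L)"
    have "(?R L)\<^sup>* \<subseteq> (?R K)\<^sup>*"
      by (rule rtrancl_mono) (use KL in auto)
    then show "U L \<subseteq> U K"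
      using U[OF K, of ?n] U[of L ?n] KL by (auto simp: component_of_def)
  qed (auto simp: U_def)
  moreover have "converges_to_end X x U"
    unfolding converges_to_end_def
  proof (intro allI impI)
    fix K assume K: "finite K \<and> K \<subseteq> X"
    then show "\<forall>\<^sub>F n in sequentially. x n \<in> U K"
      by (intro eventually_sequentiallyI[of "N K"]) (auto simp: U component_of_def)
  qed
  ultimately show ?thesis by blast
qed

text \<open>The vertices visited when the letters of a word are applied one after the other, including both
  endpoints.\<close>

primrec trail :: "('x \<Rightarrow> 'g \<Rightarrow> 'x) \<Rightarrow> 'x \<Rightarrow> 'g list \<Rightarrow> 'x set" where
  "trail act x [] = {x}"
| "trail act x (s # w) = insert x (trail act (act x s) w)"

lemma start_in_trail: "x \<in> trail act x w"
  by (cases w) auto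

context right_action
begin

lemma foldr_mult_closed: "set w \<subseteq> carrier G \<Longrightarrow> foldr (\<otimes>) w \<one> \<in> carrier G"
  by (induction w) auto

lemma trail_avoiding_connected:
  assumes S: "S \<subseteq> carrier G" and w: "set w \<subseteq> S \<union> m_inv G ` S" and x: "x \<in> X"
    and K: "trail act x w \<inter> K = {}"
  shows "(x, act x (foldr (\<otimes>) w \<one>)) \<in> (schreier_adj X act S \<inter> (X - K) \<times> (X - K))\<^sup>*"
  using w x K
proof (induction w arbitrary: x)
  case Nil
  then show ?case by (simp add: act_one)
next
  case (Cons s w)
  have sub: "S \<union> m_inv G ` S \<subseteq> carrier G" using S by auto
  then have s: "s \<in> carrier G" and w: "set w \<subseteq> carrier G"
    using Cons.prems(1) by (simp_all add: subset_iff del: Un_iff)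
  have y: "act x s \<in> X" using s Cons.prems(2) by (rule act_closed[rotated])
  have "(x, act x s) \<in> schreier_adj X act S"
  proof (cases "s \<in> S")
    case True
    then show ?thesis using Cons.prems(2) by (auto simp: schreier_adj_def Let_def)
  next
    case False
    then obtain t where t: "t \<in> S" "s = inv t" using Cons.prems(1) by auto
    then have "(act x s, act (act x s) t) \<in> schreier_adj X act S"
      using y by (auto simp: schreier_adj_def Let_def)
    then show ?thesis
      using t S Cons.prems(2) sym_schreier_adj[of S] by (auto simp: act_inv subset_iff dest: symD)
  qed
  moreover have "x \<notin> K" "act x s \<notin> K"
    using Cons.prems(3) start_in_trail[of "act x s" act w] by auto
  ultimately have "(x, act x s) \<in> schreier_adj X act S \<inter> (X - K) \<times> (X - K)"
    using Cons.prems(2) y by auto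
  moreover have "(act x s, act (act x s) (foldr (\<otimes>) w \<one>)) \<in> (schreier_adj X act S \<inter> (X - K) \<times> (X - K))\<^sup>*"
    using Cons.prems y by (intro Cons.IH) auto
  ultimately have "(x, act (act x s) (foldr (\<otimes>) w \<one>)) \<in> (schreier_adj X act S \<inter> (X - K) \<times> (X - K))\<^sup>*"
    by (rule converse_rtrancl_into_rtrancl)
  then show ?case
    using Cons.prems(2) s foldr_mult_closed[OF w] by (simp add: act_mult)
qed

text \<open>Induction on the word: a trail meets \<open>K\<close> if it starts in \<open>K\<close>, or if its remainder meets \<open>K\<close>. The
  starting points of the second kind correspond bijectively to those of the remaining word, since
  the first letter permutes \<open>X\<close>. Hence each letter adds at most \<open>card K\<close> starting points.\<close>

lemma card_trails_meeting:
  assumes K: "finite K" and w: "set w \<subseteq> carrier G"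
  shows "finite {x \<in> X. trail act x w \<inter> K \<noteq> {}} \<and>
    card {x \<in> X. trail act x w \<inter> K \<noteq> {}} \<le> (length w + 1) * card K"
  using w
proof (induction w)
  case Nil
  have "{x \<in> X. trail act x [] \<inter> K \<noteq> {}} \<subseteq> K" by auto
  then show ?case using K by (auto intro: finite_subset card_mono)
next
  case (Cons s w)
  let ?B = "{x \<in> X. trail act x w \<inter> K \<noteq> {}}"
  have s: "s \<in> carrier G" using Cons.prems by auto
  have B: "finite ?B" "card ?B \<le> (length w + 1) * card K" using Cons by auto
  have sub: "{x \<in> X. trail act x (s # w) \<inter> K \<noteq> {}} \<subseteq> K \<union> (\<lambda>x. act x (inv s)) ` ?B"
  proof
    fix x assume x: "x \<in> {x \<in> X. trail act x (s # w) \<inter> K \<noteq> {}}"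
    show "x \<in> K \<union> (\<lambda>x. act x (inv s)) ` ?B"
    proof (cases "x \<in> K")
      case False
      then have "act x s \<in> ?B" using x s by (auto simp: act_closed)
      moreover have "x = act (act x s) (inv s)" using x s by (simp add: act_inv)
      ultimately show ?thesis by blast
    qed simp
  qed
  have fin: "finite (K \<union> (\<lambda>x. act x (inv s)) ` ?B)" using K B by simp
  have "card {x \<in> X. trail act x (s # w) \<inter> K \<noteq> {}} \<le> card (K \<union> (\<lambda>x. act x (inv s)) ` ?B)"
    by (rule card_mono[OF fin sub])
  also have "\<dots> \<le> card K + card ?B"
    by (rule order_trans[OF card_Un_le]) (simp add: card_image_le B)
  also have "\<dots> \<le> (length (s # w) + 1) * card K" using B by simp
  finally show ?case using finite_subset[OF sub fin] by blast
qed

lemma generate_word: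
  assumes S: "S \<subseteq> carrier G" and g: "g \<in> generate G S"
  shows "\<exists>w. set w \<subseteq> S \<union> m_inv G ` S \<and> foldr (\<otimes>) w \<one> = g"
  using g
proof induction
  case one
  show ?case by (rule exI[of _ "[]"]) simp
next
  case (incl h)
  then show ?case using S by (intro exI[of _ "[h]"]) auto
next
  case (inv h)
  then show ?case using S by (intro exI[of _ "[m_inv G h]"]) auto
next
  case (eng h1 h2)
  then obtain u v where u: "set u \<subseteq> S \<union> m_inv G ` S" "foldr (\<otimes>) u \<one> = h1"
    and v: "set v \<subseteq> S \<union> m_inv G ` S" "foldr (\<otimes>) v \<one> = h2" by auto
  have sub: "S \<union> m_inv G ` S \<subseteq> carrier G" using S by auto
  have v': "foldr (\<otimes>) v \<one> \<in> carrier G"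
    using v(1) sub by (intro foldr_mult_closed) blast
  have "foldr (\<otimes>) (u @ v) \<one> = foldr (\<otimes>) u \<one> \<otimes> foldr (\<otimes>) v \<one>"
    using u(1)
  proof (induction u)
    case (Cons s u)
    then have "s \<in> carrier G" "set u \<subseteq> carrier G"
      using sub by (simp_all add: subset_iff del: Un_iff)
    then show ?case
      using Cons foldr_mult_closed[of u] v' by (simp add: m_assoc)
  qed (use v' in simp)
  then show ?case using u v by (intro exI[of _ "u @ v"]) auto
qed

lemma geodesic_word:
  assumes "finite_generating_set G S" "g \<in> carrier G"
  obtains w where "set w \<subseteq> S \<union> m_inv G ` S" "foldr (\<otimes>) w \<one> = g" "length w = word_length G S g"
proof -
  let ?P = "\<lambda>n. \<exists>w. length w = n \<and> set w \<subseteq> S \<union> m_inv G ` S \<and> foldr (\<otimes>) w \<one> = g"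
  have "\<exists>w. set w \<subseteq> S \<union> m_inv G ` S \<and> foldr (\<otimes>) w \<one> = g"
    using assms generate_word[of S g] by (auto simp: finite_generating_set_def)
  then have "\<exists>n. ?P n" by blast
  then have "?P (word_length G S g)"
    unfolding word_length_def by (rule LeastI_ex)
  then show ?thesis using that by blast
qed

lemma countable_carrier:
  assumes "finite_generating_set G S"
  shows "countable (carrier G)"
proof (rule countable_subset)
  show "carrier G \<subseteq> (\<lambda>w. foldr (\<otimes>) w \<one>) ` lists (S \<union> m_inv G ` S)"
  proof
    fix g assume "g \<in> carrier G"
    then obtain w where "set w \<subseteq> S \<union> m_inv G ` S" "foldr (\<otimes>) w \<one> = g"
      by (rule geodesic_word[OF assms])
    then show "g \<in> (\<lambda>w. foldr (\<otimes>) w \<one>) ` lists (S \<union> m_inv G ` S)"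
      by (auto simp: lists_eq_set)
  qed
  show "countable ((\<lambda>w. foldr (\<otimes>) w \<one>) ` lists (S \<union> m_inv G ` S))"
    using assms by (auto simp: finite_generating_set_def intro: countable_finite)
qed

end

lemma (in transitive_right_action) countable_space:
  assumes "countable (carrier G)"
  shows "countable X"
proof (cases "X = {}")
  case False
  then obtain x where x: "x \<in> X" by blast
  then have "X \<subseteq> act x ` carrier G"
    using transitive by blast
  then show ?thesis using assms by (auto intro: countable_subset)
qed simp


section \<open>Convergence to an end\<close>

lemma nn_integral_pmf_finite_moment:
  assumes "(\<lambda>g. f g * pmf p g) summable_on B" "set_pmf p \<subseteq> B" "\<And>g. 0 \<le> f g"
  shows "(\<integral>\<^sup>+g. ennreal (f g) \<partial>measure_pmf p) < \<infinity>"
proof -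
  note summ = assms(1)[THEN summable_on_iff_abs_summable_on_real[THEN iffD1],
      THEN abs_summable_equivalent[THEN iffD1]]
  have "(\<integral>\<^sup>+g. ennreal (f g) \<partial>measure_pmf p) = (\<integral>\<^sup>+g. ennreal (f g * pmf p g) \<partial>count_space UNIV)"
    using assms(3) by (simp add: nn_integral_measure_pmf ennreal_mult mult.commute)
  also have "\<dots> = (\<integral>\<^sup>+g. ennreal (f g * pmf p g) \<partial>count_space B)"
  proof (rule nn_integral_count_space_eq)
    fix g assume "g \<in> UNIV - B"
    then have "pmf p g = 0" using assms(2) by (auto simp: set_pmf_iff)
    then show "ennreal (f g * pmf p g) = 0" by simp
  qed auto
  also have "\<dots> < \<infinity>"
    using nn_integral_conv_infsetsum[OF summ] assms(3) by simp
  finally show ?thesis .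
qed

lemma (in prob_space) AE_iid_support:
  assumes "iid_sequence M \<mu> h"
  shows "AE \<omega> in M. \<forall>n. h n \<omega> \<in> set_pmf \<mu>"
proof -
  have "AE \<omega> in M. h n \<omega> \<in> set_pmf \<mu>" for n
  proof -
    have m: "h n \<in> measurable M (count_space UNIV)"
      using assms by (auto simp: iid_sequence_def indep_vars_def)
    have law: "distr M (count_space UNIV) (h n) = measure_pmf \<mu>"
      using assms by (simp add: iid_sequence_def)
    have "AE g in distr M (count_space UNIV) (h n). g \<in> set_pmf \<mu>"
      unfolding law by (rule AE_measure_pmf)
    from AE_distrD[OF m this] show ?thesis .
  qed
  then show ?thesis by (simp add: AE_all_countable)
qed

context right_action
begin

text \<open>Interchange the sum over starting points with the average over \<open>g\<close> and count the starting points of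
  each word.\<close>

lemma expected_hits_bound:
  fixes word :: "'g \<Rightarrow> 'g list"
  assumes X: "countable X" and K: "finite K"
    and word: "\<And>g. g \<in> carrier G \<Longrightarrow> set (word g) \<subseteq> carrier G"
    and \<mu>: "set_pmf \<mu> \<subseteq> carrier G"
  shows "(\<integral>\<^sup>+x. emeasure (measure_pmf \<mu>) {g. trail act x (word g) \<inter> K \<noteq> {}} \<partial>count_space X)
    \<le> of_nat (card K) * (\<integral>\<^sup>+g. ennreal (real (length (word g) + 1)) \<partial>measure_pmf \<mu>)"
proof -
  let ?H = "\<lambda>x. {g. trail act x (word g) \<inter> K \<noteq> {}}"
  interpret cX: sigma_finite_measure "count_space X"
    by (rule sigma_finite_measure_count_space_countable[OF X])
  interpret pair_sigma_finite "count_space X" "measure_pmf \<mu>" ..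
  have "(\<integral>\<^sup>+x. emeasure (measure_pmf \<mu>) (?H x) \<partial>count_space X) =
      (\<integral>\<^sup>+x. \<integral>\<^sup>+g. indicator (?H x) g \<partial>measure_pmf \<mu> \<partial>count_space X)"
    by simp
  also have "\<dots> = (\<integral>\<^sup>+g. \<integral>\<^sup>+x. indicator (?H x) g \<partial>count_space X \<partial>measure_pmf \<mu>)"
    by (rule Fubini'[symmetric]) (intro measurable_pair_measure_countable1 X, simp)
  also have "\<dots> \<le> (\<integral>\<^sup>+g. of_nat (card K) * ennreal (real (length (word g) + 1)) \<partial>measure_pmf \<mu>)"
  proof (rule nn_integral_mono_AE, rule AE_pmfI)
    fix g assume "g \<in> set_pmf \<mu>"
    then have w: "set (word g) \<subseteq> carrier G" using \<mu> word by auto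
    let ?T = "{x \<in> X. trail act x (word g) \<inter> K \<noteq> {}}"
    note T = card_trails_meeting[OF K w]
    have "(\<integral>\<^sup>+x. indicator (?H x) g \<partial>count_space X) = (\<integral>\<^sup>+x. indicator ?T x \<partial>count_space X)"
      by (intro nn_integral_cong) (auto split: split_indicator)
    also have "\<dots> = of_nat (card ?T)"
      using T by (subst nn_integral_indicator) (auto simp: emeasure_count_space)
    also have "\<dots> \<le> of_nat ((length (word g) + 1) * card K)"
      using T by (intro of_nat_mono) auto
    also have "\<dots> = of_nat (card K) * ennreal (real (length (word g) + 1))"
      unfolding ennreal_of_nat_eq_real_of_nat[symmetric] of_nat_mult by (rule mult.commute)
    finally show "(\<integral>\<^sup>+x. indicator (?H x) g \<partial>count_space X) \<le>
      of_nat (card K) * ennreal (real (length (word g) + 1))" .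
  qed
  also have "\<dots> = of_nat (card K) * (\<integral>\<^sup>+g. ennreal (real (length (word g) + 1)) \<partial>measure_pmf \<mu>)"
    by (rule nn_integral_cmult) simp
  finally show ?thesis .
qed

text \<open>Borel--Cantelli for the events \<open>B n\<close> that the trail of the step at time \<open>n\<close> meets \<open>K\<close>. Given the
  position \<open>x\<close>, the increment still has law \<open>\<mu>\<close>, so the probabilities sum to the Green function
  integrated against \<open>\<mu> {g. the trail of g from x meets K}\<close>.\<close>

lemma AE_steps_eventually_avoid:
  fixes word :: "'g \<Rightarrow> 'g list" and h :: "nat \<Rightarrow> 'w \<Rightarrow> 'g"
  assumes iid: "iid_sequence M \<mu> h" and \<mu>: "set_pmf \<mu> \<subseteq> carrier G"
    and X: "countable X" "a \<in> X" and K: "finite K"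
    and C: "\<And>N x. (\<Sum>n<N. pmf (chain_law (\<lambda>_. walk_kernel \<mu>) a n) x) \<le> C"
    and word: "\<And>g. g \<in> carrier G \<Longrightarrow> set (word g) \<subseteq> carrier G"
    and moment: "(\<integral>\<^sup>+g. ennreal (real (length (word g) + 1)) \<partial>measure_pmf \<mu>) < \<infinity>"
  shows "AE \<omega> in M. \<forall>\<^sub>F n in sequentially.
    trail act (act a (group_walk G (\<lambda>k. h k \<omega>) n)) (word (h n \<omega>)) \<inter> K = {}"
proof -
  interpret prob_space M using iid by (simp add: iid_sequence_def)
  have indep: "indep_vars (\<lambda>_. count_space UNIV) h UNIV"
    and distr_h: "distr M (count_space UNIV) (h n) = measure_pmf \<mu>" for n
    using iid by (auto simp: iid_sequence_def)
  have hm: "h n \<in> measurable M (count_space UNIV)" for n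
    using indep by (auto simp: indep_vars_def)
  (* Increments outside the carrier have probability 0; ignoring them keeps the chain in X everywhere. *)
  let ?F = "\<lambda>(n::nat) z g. if g \<in> carrier G then act z g else z"
  let ?Y = "\<lambda>n \<omega>. driven_chain ?F a (\<lambda>n. h n \<omega>) n"
  let ?p = "\<lambda>n. pmf (chain_law (\<lambda>_. walk_kernel \<mu>) a n)"
  let ?H = "\<lambda>x. {g. trail act x (word g) \<inter> K \<noteq> {}}"
  have F: "?F n z \<in> measurable (count_space UNIV) (count_space X)" if "z \<in> X" for n z
    using that by (auto simp: act_closed)
  have prob_h: "prob {\<omega> \<in> space M. h n \<omega> \<in> B} = measure_pmf.prob \<mu> B" for n B
  proof -
    have "measure (distr M (count_space UNIV) (h n)) B = prob (h n -` B \<inter> space M)"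
      by (rule measure_distr[OF hm]) simp
    then show ?thesis
      by (simp add: distr_h vimage_def Int_def conj_commute)
  qed
  have step: "prob {\<omega> \<in> space M. ?F n z (h n \<omega>) = y} = pmf (walk_kernel \<mu> z) y" for n z y
  proof -
    have "prob {\<omega> \<in> space M. ?F n z (h n \<omega>) = y} = measure_pmf.prob \<mu> {g. ?F n z g = y}"
      using prob_h[of n "{g. ?F n z g = y}"] by simp
    also have "\<dots> = measure_pmf.prob \<mu> (act z -` {y})"
      using \<mu> by (intro measure_eq_AE) (auto simp: AE_measure_pmf_iff subset_iff)
    finally show ?thesis by (simp add: pmf_map)
  qed
  have Ym: "?Y n \<in> measurable M (count_space X)" for n
    by (rule measurable_driven_chain[OF indep X]) (rule F)
  have law: "prob {\<omega> \<in> space M. ?Y n \<omega> = x} = ?p n x" if "x \<in> X" for n x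
    by (rule prob_driven_chain[OF indep X]) (use F step set_walk_kernel[OF \<mu>] that in auto)
  let ?E = "\<lambda>n x. {\<omega> \<in> space M. ?Y n \<omega> = x \<and> h n \<omega> \<in> ?H x}"
  have E: "prob (?E n x) = ?p n x * measure_pmf.prob \<mu> (?H x)" if "x \<in> X" for n x
  proof -
    have "prob (?E n x) = prob {\<omega> \<in> space M. ?Y n \<omega> = x} * prob {\<omega> \<in> space M. h n \<omega> \<in> ?H x}"
      by (rule prob_driven_chain_noise[OF indep X F that]) simp_all
    then show ?thesis unfolding law[OF that] prob_h .
  qed
  have E_sets: "?E n x \<in> sets M" if "x \<in> X" for n x
  proof -
    have "?Y n -` {x} \<inter> space M \<in> sets M" "h n -` ?H x \<inter> space M \<in> sets M"
      using measurable_sets[OF Ym, of "{x}" n] measurable_sets[OF hm, of "?H x" n] that by simp_all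
    then have "(?Y n -` {x} \<inter> space M) \<inter> (h n -` ?H x \<inter> space M) \<in> sets M"
      by (rule sets.Int)
    also have "(?Y n -` {x} \<inter> space M) \<inter> (h n -` ?H x \<inter> space M) = ?E n x"
      by blast
    finally show ?thesis .
  qed
  define B where "B n = (\<Union>x\<in>X. ?E n x)" for n
  have B_sets: "B n \<in> sets M" for n
    unfolding B_def using X(1) by (intro sets.countable_UN'' E_sets)
  have B: "emeasure M (B n) = (\<integral>\<^sup>+x. ennreal (?p n x) * emeasure (measure_pmf \<mu>) (?H x) \<partial>count_space X)" for n
  proof -
    have "emeasure M (B n) = (\<integral>\<^sup>+x. emeasure M (?E n x) \<partial>count_space X)"
      unfolding B_def by (rule emeasure_UN_countable[OF E_sets X(1)]) (auto simp: disjoint_family_on_def)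
    also have "\<dots> = (\<integral>\<^sup>+x. ennreal (?p n x) * emeasure (measure_pmf \<mu>) (?H x) \<partial>count_space X)"
      by (intro nn_integral_cong)
         (simp only: space_count_space emeasure_eq_measure measure_pmf.emeasure_eq_measure E ennreal_mult
           pmf_nonneg measure_nonneg)
    finally show ?thesis .
  qed
  let ?T = "\<integral>\<^sup>+x. emeasure (measure_pmf \<mu>) (?H x) \<partial>count_space X"
  have "?T \<le> of_nat (card K) * (\<integral>\<^sup>+g. ennreal (real (length (word g) + 1)) \<partial>measure_pmf \<mu>)"
    by (rule expected_hits_bound[OF X(1) K word \<mu>])
  also have "\<dots> < \<infinity>"
    using moment by (simp add: ennreal_mult_less_top of_nat_less_top)
  finally have T: "?T < \<infinity>" .
  have partial: "(\<Sum>n<N. emeasure M (B n)) \<le> ennreal C * ?T" for N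
  proof -
    have "(\<Sum>n<N. emeasure M (B n)) =
        (\<integral>\<^sup>+x. (\<Sum>n<N. ennreal (?p n x) * emeasure (measure_pmf \<mu>) (?H x)) \<partial>count_space X)"
      unfolding B by (rule nn_integral_sum[symmetric]) simp
    also have "\<dots> \<le> (\<integral>\<^sup>+x. ennreal C * emeasure (measure_pmf \<mu>) (?H x) \<partial>count_space X)"
    proof (rule nn_integral_mono)
      fix x
      have "(\<Sum>n<N. ennreal (?p n x)) = ennreal (\<Sum>n<N. ?p n x)"
        by (rule sum_ennreal) simp
      also have "\<dots> \<le> ennreal C" using C by (rule ennreal_leI)
      finally show "(\<Sum>n<N. ennreal (?p n x) * emeasure (measure_pmf \<mu>) (?H x)) \<le>
          ennreal C * emeasure (measure_pmf \<mu>) (?H x)"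
        unfolding sum_distrib_right[symmetric] by (rule mult_right_mono) simp
    qed
    also have "\<dots> = ennreal C * ?T" by (rule nn_integral_cmult) simp
    finally show ?thesis .
  qed
  have fin: "ennreal C * ?T < \<infinity>"
    using T by (simp add: ennreal_mult_less_top)
  have "summable (\<lambda>n. prob (B n))"
  proof (rule summableI_nonneg_bounded)
    fix N
    have "ennreal (\<Sum>n<N. prob (B n)) = (\<Sum>n<N. emeasure M (B n))"
      by (simp add: emeasure_eq_measure sum_ennreal)
    then have "ennreal (\<Sum>n<N. prob (B n)) \<le> ennreal (enn2real (ennreal C * ?T))"
      using partial[of N] fin by simp
    then show "(\<Sum>n<N. prob (B n)) \<le> enn2real (ennreal C * ?T)"
      by (simp add: sum_nonneg)
  qed simp
  then have "AE \<omega> in M. \<forall>\<^sub>F n in sequentially. \<omega> \<in> space M - B n"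
    by (intro borel_cantelli_AE1) (auto simp: B_sets less_top[symmetric])
  with AE_iid_support[OF iid] show ?thesis
  proof eventually_elim
    case (elim \<omega>)
    then have h: "h k \<omega> \<in> carrier G" for k using \<mu> by auto
    have walk: "group_walk G (\<lambda>k. h k \<omega>) n \<in> carrier G" for n
      by (induction n) (simp_all add: h)
    have Y: "?Y n \<omega> = act a (group_walk G (\<lambda>k. h k \<omega>) n)" for n
      by (induction n) (simp_all add: h walk act_one act_mult X)
    from elim(2) show ?case
    proof eventually_elim
      case (elim n)
      have "act a (group_walk G (\<lambda>k. h k \<omega>) n) \<in> X"
        using act_closed[OF X(2) walk] .
      then show ?case using elim by (auto simp: B_def Y)
    qed
  qed
qed

end

theorem corollary1p2:
  fixes G :: "('g, 'm) monoid_scheme"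
    and X :: "'x set" and act :: "'x \<Rightarrow> 'g \<Rightarrow> 'x"
    and S :: "'g set" and \<mu> :: "'g pmf"
    and M :: "'w measure" and h :: "nat \<Rightarrow> 'w \<Rightarrow> 'g" and x\<^sub>0 :: 'x
  assumes "transitive_right_action G X act"
    and "finite_generating_set G S"
    and "transient_graph X (schreier_adj X act S)"
    and "set_pmf \<mu> \<subseteq> carrier G"
    and "finite_first_moment G S \<mu>"
    and "semigroup_generate G (set_pmf \<mu>) = carrier G"
    and "iid_sequence M \<mu> h"
    and "x\<^sub>0 \<in> X"
  shows "AE \<omega> in M. \<exists>U \<in> graph_ends X (schreier_adj X act S).
           converges_to_end X (\<lambda>n. act x\<^sub>0 (group_walk G (\<lambda>k. h k \<omega>) n)) U"
proof -
  interpret transitive_right_action G X act by fact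
  interpret prob_space M using assms(7) by (simp add: iid_sequence_def)
  have S: "finite S" "S \<subseteq> carrier G"
    using assms(2) by (auto simp: finite_generating_set_def)
  have X: "countable X"
    by (rule countable_space[OF countable_carrier[OF assms(2)]])
  have "\<forall>g\<in>carrier G. \<exists>w. set w \<subseteq> S \<union> m_inv G ` S \<and> foldr (mult G) w (one G) = g \<and> length w = word_length G S g"
    using geodesic_word[OF assms(2)] by metis
  then obtain word where word: "\<And>g. g \<in> carrier G \<Longrightarrow> set (word g) \<subseteq> S \<union> m_inv G ` S"
    "\<And>g. g \<in> carrier G \<Longrightarrow> foldr (mult G) (word g) (one G) = g"
    "\<And>g. g \<in> carrier G \<Longrightarrow> length (word g) = word_length G S g"
    unfolding bchoice_iff by blast
  have word_carrier: "set (word g) \<subseteq> carrier G" if "g \<in> carrier G" for g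
    using word(1)[OF that] S(2) by auto
  obtain C where C: "\<And>N x. (\<Sum>n<N. pmf (chain_law (\<lambda>_. walk_kernel \<mu>) x\<^sub>0 n) x) \<le> C"
    by (rule green_function_bounded[OF assms(4,6) S X assms(8,3)]) (rule that)
  have moment: "(\<integral>\<^sup>+g. ennreal (real (length (word g) + 1)) \<partial>measure_pmf \<mu>) < \<infinity>"
  proof -
    have "(\<integral>\<^sup>+g. ennreal (real (length (word g) + 1)) \<partial>measure_pmf \<mu>) =
        (\<integral>\<^sup>+g. ennreal (real (word_length G S g)) + 1 \<partial>measure_pmf \<mu>)"
      using assms(4) word(3)
      by (intro nn_integral_cong_AE) (auto simp: AE_measure_pmf_iff subset_iff ennreal_plus)
    also have "\<dots> = (\<integral>\<^sup>+g. ennreal (real (word_length G S g)) \<partial>measure_pmf \<mu>) + 1"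
      by (subst nn_integral_add) auto
    also have "\<dots> < \<infinity>"
      using nn_integral_pmf_finite_moment[OF assms(5)[unfolded finite_first_moment_def] assms(4)] by simp
    finally show ?thesis .
  qed
  have "AE \<omega> in M. \<forall>K\<in>{K. finite K \<and> K \<subseteq> X}. \<forall>\<^sub>F n in sequentially.
      trail act (act x\<^sub>0 (group_walk G (\<lambda>k. h k \<omega>) n)) (word (h n \<omega>)) \<inter> K = {}"
    using AE_steps_eventually_avoid[OF assms(7,4) X assms(8) _ C word_carrier moment]
    by (subst AE_ball_countable[OF countable_Collect_finite_subset[OF X]]) auto
  with AE_iid_support[OF assms(7)] show ?thesis
  proof eventually_elim
    case (elim \<omega>)
    then have h: "h k \<omega> \<in> carrier G" for k using assms(4) by auto
    have walk: "group_walk G (\<lambda>k. h k \<omega>) n \<in> carrier G" for n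
      by (induction n) (simp_all add: h)
    let ?x = "\<lambda>n. act x\<^sub>0 (group_walk G (\<lambda>k. h k \<omega>) n)"
    have x: "?x n \<in> X" "?x (Suc n) = act (?x n) (h n \<omega>)" for n
      using assms(8) by (simp_all add: h walk act_closed act_mult)
    show ?case
    proof (rule converges_to_end_if_stays_connected[OF sym_schreier_adj])
      fix K assume "finite K" "K \<subseteq> X"
      with elim(2) have "\<forall>\<^sub>F n in sequentially. trail act (?x n) (word (h n \<omega>)) \<inter> K = {}" by blast
      then show "\<forall>\<^sub>F n in sequentially. ?x n \<in> X - K \<and>
          (?x n, ?x (Suc n)) \<in> (schreier_adj X act S \<inter> (X - K) \<times> (X - K))\<^sup>*"
      proof eventually_elim
        case (elim n)
        have "(?x n, act (?x n) (h n \<omega>)) \<in> (schreier_adj X act S \<inter> (X - K) \<times> (X - K))\<^sup>*"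
          using trail_avoiding_connected[OF S(2) word(1)[OF h] x(1) elim] word(2)[OF h] by simp
        then show ?case
          using x elim start_in_trail[of "?x n" act "word (h n \<omega>)"] by auto
      qed
    qed
  qed
qed

end
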